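(* Let $K=\mathbb{Q}(\sqrt D)$ be a real quadratic field, regarded as a subfield of $\mathbb{R}$ via a fixed embedding. If the inhomogeneous minimum $M_i(\overline{K})$ is isolated, then there is a $K$-point $P\in\mathbb{T}_K$ with $M(P)=M_i(\overline K)$, and $M_i(\overline{K})\in K$.
   Context: $D>1$ is a square-free integer, $K=\mathbb{Q}(\sqrt D)$ is regarded as a subfield of $\mathbb{R}$ via a fixed embedding, $\mathcal{O}_K$ is its ring of integers, and $a\mapsto\overline a$ is Galois conjugation. Let $V_K=K\otimes_{\mathbb{Q}}\mathbb{R}$, identified with $\mathbb{R}\times\mathbb{R}$ as an $\mathbb{R}$-algebra by $a\otimes 1\mapsto(\overline a,a)$; the resulting coordinates are denoted $(s,u)$. The ring $\mathcal{O}_K$ embeds as the lattice $\{(\overline a,a): a\in\mathcal{O}_K\}$ in $V_K$, and $\mathbb{T}_K=V_K/\mathcal{O}_K$ is the quotient torus. The absolute norm is $\mathbf{N}(s,u)=|su|$ on $V_K$. For $P\in V_K$ put $M(P)=\inf_{Q\in\mathcal{O}_K}\mathbf{N}(P-Q)$; this is $\mathcal{O}_K$-invariant and so defines a function $M:\mathbb{T}_K\to\mathbb{R}$. The inhomogeneous minima of $K$ are defined by $M_1(\overline K)=\sup_{P\in\mathbb{T}_K}M(P)$ and, successively, $M_{i+1}(\overline K)=\sup\{M(P): P\in\mathbb{T}_K,\ M(P)<M_i(\overline K)\}$. The minimum $M_i(\overline K)$ is called isolated if $M_{i+1}(\overline K)<M_i(\overline K)$. The process is continued only until a non-isolated minimum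 is found, so $M_{i}(\overline K)$ is considered only if $M_1(\overline K),\dots,M_{i-1}(\overline K)$ are all isolated. A $K$-point of $\mathbb{T}_K$ is a point represented by an element of $V_K$ whose coordinates with respect to a $\mathbb{Z}$-basis of $\mathcal{O}_K$ lie in $K$, equivalently whose $(s,u)$ coordinates both lie in $K$. *)

theory Defs
  imports "HOL-Analysis.Analysis" "HOL-Computational_Algebra.Squarefree"
begin

definition quad_field :: "int \<Rightarrow> real set" where
  "quad_field D = {a + b * sqrt (of_int D) | a b. a \<in> \<rat> \<and> b \<in> \<rat>}"

definition quad_conj :: "int \<Rightarrow> real \<Rightarrow> real" where
  "quad_conj D x = (THE y. \<exists>a\<in>\<rat>. \<exists>b\<in>\<rat>.
     x = a + b * sqrt (of_int D) \<and> y = a - b * sqrt (of_int D))"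

definition quad_ints :: "int \<Rightarrow> real set" where
  "quad_ints D = {x \<in> quad_field D. algebraic_int x}"

text \<open>
  The space \<open>V\<^sub>K = K \<otimes> \<real>\<close> is the type \<^typ>\<open>real \<times> real\<close> of pairs \<open>(s, u)\<close>, an
  element \<open>a\<close> of the field being sent to (conjugate of \<open>a\<close>, \<open>a\<close>).
\<close>

definition quad_embed :: "int \<Rightarrow> real \<Rightarrow> real \<times> real" where
  "quad_embed D a = (quad_conj D a, a)"

definition quad_lattice :: "int \<Rightarrow> (real \<times> real) set" where
  "quad_lattice D = quad_embed D ` quad_ints D"

definition torus_rel :: "int \<Rightarrow> ((real \<times> real) \<times> (real \<times> real)) set" where
  "torus_rel D = {(P, Q). P - Q \<in> quad_lattice D}"

definition quad_torus :: "int \<Rightarrow> (real \<times> real) set set" where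
  "quad_torus D = UNIV // torus_rel D"

definition abs_norm :: "real \<times> real \<Rightarrow> real" where
  "abs_norm P = \<bar>fst P * snd P\<bar>"

definition inhom_M :: "int \<Rightarrow> real \<times> real \<Rightarrow> real" where
  "inhom_M D P = (INF Q\<in>quad_lattice D. abs_norm (P - Q))"

text \<open>
  Since \<^const>\<open>inhom_M\<close> is constant on each coset, its image on a coset is a singleton.
\<close>

definition torus_M :: "int \<Rightarrow> (real \<times> real) set \<Rightarrow> real" where
  "torus_M D X = the_elem (inhom_M D ` X)"

text \<open>
  The minima are numbered from 1; the value at index 0 is left unspecified.  Both
  suprema are over nonempty bounded sets when \<open>D > 1\<close> is squarefree: \<^const>\<open>torus_M\<close> is bounded and takes
  arbitrarily small positive values.
\<close>

fun inhom_min :: "int \<Rightarrow> nat \<Rightarrow> real" where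
  "inhom_min D (Suc 0) = (SUP X\<in>quad_torus D. torus_M D X)"
| "inhom_min D (Suc (Suc i)) =
     Sup {torus_M D X | X. X \<in> quad_torus D \<and> torus_M D X < inhom_min D (Suc i)}"

definition isolated_min :: "int \<Rightarrow> nat \<Rightarrow> bool" where
  "isolated_min D i \<longleftrightarrow> inhom_min D (Suc i) < inhom_min D i"

definition min_considered :: "int \<Rightarrow> nat \<Rightarrow> bool" where
  "min_considered D i \<longleftrightarrow> i \<ge> 1 \<and> (\<forall>j\<in>{1..<i}. isolated_min D j)"

definition is_int_basis :: "int \<Rightarrow> real \<Rightarrow> real \<Rightarrow> bool" where
  "is_int_basis D w1 w2 \<longleftrightarrow> w1 \<in> quad_ints D \<and> w2 \<in> quad_ints D \<and>
     (\<forall>a\<in>quad_ints D. \<exists>!(m::int, n::int). a = of_int m * w1 + of_int n * w2)"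

definition K_points :: "int \<Rightarrow> (real \<times> real) set set" where
  "K_points D = {X \<in> quad_torus D. \<exists>P\<in>X. \<exists>w1 w2. is_int_basis D w1 w2 \<and>
     (\<exists>x\<in>quad_field D. \<exists>y\<in>quad_field D.
        P = x *\<^sub>R quad_embed D w1 + y *\<^sub>R quad_embed D w2)}"

lemma sqrt_squarefree_irrational:
  assumes "squarefree D" "D > (1::int)"
  shows "sqrt (of_int D) \<notin> \<rat>"
proof
  assume rat: "sqrt (of_int D) \<in> \<rat>"
  have "algebraic_int (sqrt (of_int D))"
    by (rule algebraic_int_sqrt) (rule int_imp_algebraic_int, simp)
  with rat have "sqrt (of_int D) \<in> \<int>"
    by (rule rational_algebraic_int_is_int[rotated])
  then obtain n :: int where n: "sqrt (of_int D) = of_int n"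
    by (elim Ints_cases)
  have "real_of_int D = (sqrt (of_int D))\<^sup>2"
    using assms(2) by simp
  hence "of_int D = (of_int (n\<^sup>2) :: real)"
    unfolding n by simp
  hence D: "D = n\<^sup>2"
    by (simp only: of_int_eq_iff)
  hence "is_unit n"
    using assms(1) by (auto simp: squarefree_def)
  hence "n\<^sup>2 = 1"
    by (simp add: zdvd1_eq power2_eq_1_iff abs_if split: if_splits)
  thus False using D assms(2) by simp
qed

lemma quad_repr_unique:
  assumes "squarefree D" "D > (1::int)" "a \<in> \<rat>" "b \<in> \<rat>" "c \<in> \<rat>" "d \<in> \<rat>"
    and eq: "a + b * sqrt (of_int D) = c + d * sqrt (of_int D)"
  shows "a = c \<and> b = d"
proof -
  have "b = d"
  proof (rule ccontr)
    assume "b \<noteq> d"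
    hence "sqrt (of_int D) = (c - a) / (b - d)"
      using eq by (simp add: field_simps)
    hence "sqrt (of_int D) \<in> \<rat>"
      using assms(3-6) by simp
    thus False
      using sqrt_squarefree_irrational[OF assms(1,2)] by contradiction
  qed
  thus ?thesis using eq by simp
qed

lemma quad_conj_eq:
  assumes "squarefree D" "D > (1::int)" "a \<in> \<rat>" "b \<in> \<rat>"
  shows "quad_conj D (a + b * sqrt (of_int D)) = a - b * sqrt (of_int D)"
  unfolding quad_conj_def
proof (rule the_equality)
  show "\<exists>a'\<in>\<rat>. \<exists>b'\<in>\<rat>. a + b * sqrt (of_int D) = a' + b' * sqrt (of_int D) \<and>
      a - b * sqrt (of_int D) = a' - b' * sqrt (of_int D)"
    using assms by blast
next
  fix y
  assume "\<exists>a'\<in>\<rat>. \<exists>b'\<in>\<rat>. a + b * sqrt (of_int D) = a' + b' * sqrt (of_int D) \<and>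
      y = a' - b' * sqrt (of_int D)"
  thus "y = a - b * sqrt (of_int D)"
    using quad_repr_unique[OF assms] by blast
qed

end

theory Submission
  imports Defs
begin

text \<open>
  A unit \<open>e > 1\<close> of norm 1 acts on the torus by the hyperbolic automorphism
  \<open>(s, u) \<mapsto> (s / e, e u)\<close>, which preserves the norm.  Every difference \<open>P - Q\<close> of bounded norm
  can be moved by the action into a fixed box, so \<open>M P\<close> is an infimum of uniformly continuous
  quantities along the orbit of \<open>P\<close>: if each orbit point of \<open>P'\<close> is close to some orbit point of
  \<open>P\<close>, then \<open>M P'\<close> is not much smaller than \<open>M P\<close>.  Together with upper semicontinuity, a point
  \<open>P'\<close> near \<open>P\<close> whose orbit shadows that of \<open>P\<close> has \<open>M P'\<close> close to \<open>M P\<close>.  Such a \<open>P'\<close> is found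
  among the points asymptotic to periodic (rational) orbits in both directions, which
  are exactly the \<open>K\<close>-points: the forward and the backward orbit of \<open>P\<close> each nearly close up by
  compactness, and closing them up exactly yields the coordinates \<open>u'\<close> and \<open>s'\<close>.  So the values of \<open>M\<close>
  at \<open>K\<close>-points approximate every value of \<open>M\<close>; an isolated minimum is a value
  of \<open>M\<close>, hence is equal to one of them.
\<close>

text \<open>In lowest terms \<open>p / q\<close> every \<open>q ^ i\<close> divides
  \<open>N\<close>; taking \<open>i = N\<close> forces \<open>q = 1\<close>, since
  \<open>2 ^ N > N\<close>. This turns bounded denominators of the powers of a norm into
  integrality.\<close>

lemma rat_power_denom_Ints:
  fixes r :: real and N :: int
  assumes "r \<in> \<rat>" "N > 0" and int: "\<And>i. of_int N * r ^ i \<in> \<int>"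
  shows "r \<in> \<int>"
proof -
  obtain p q :: int where r: "r = of_int p / of_int q" and q: "q > 0" and cop: "coprime p q"
    using assms(1) by (metis Rats_cases')
  have "q ^ i dvd N" for i
  proof -
    obtain z where z: "of_int N * r ^ i = of_int z" using int Ints_cases by metis
    have "of_int (N * p ^ i) = (of_int (z * q ^ i) :: real)"
      using z q by (simp add: r power_divide field_simps)
    hence "N * p ^ i = z * q ^ i" by (simp only: of_int_eq_iff)
    hence "q ^ i dvd N * p ^ i" by simp
    thus ?thesis using cop by (simp add: coprime_dvd_mult_left_iff coprime_commute)
  qed
  from this[of "nat N"] have le: "q ^ nat N \<le> N" using assms(2) zdvd_imp_le by blast
  have "q = 1"
  proof (rule ccontr)
    assume "q \<noteq> 1"
    hence "2 ^ nat N \<le> q ^ nat N" using q by (intro power_mono) auto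
    moreover have "N < 2 ^ nat N" using of_nat_less_two_power[where 'a=int, of "nat N"] assms(2) by simp
    ultimately show False using le by linarith
  qed
  thus ?thesis by (simp add: r)
qed

subsection \<open>The field, its integers and the lattice\<close>

locale real_quadratic =
  fixes D :: int
  assumes D_gt_1: "D > 1" and sqfree: "squarefree D"
begin

definition r :: real where "r = sqrt (of_int D)"

lemma r_sq [simp]: "r * r = of_int D" using D_gt_1 by (simp add: r_def)
lemma r_pos: "r > 0" using D_gt_1 by (simp add: r_def)

lemma r_irrat: "r \<notin> \<rat>"
  using sqrt_squarefree_irrational sqfree D_gt_1 unfolding r_def by blast

lemma repr_unique:
  "\<lbrakk>a \<in> \<rat>; b \<in> \<rat>; c \<in> \<rat>; d \<in> \<rat>; a + b * r = c + d * r\<rbrakk> \<Longrightarrow> a = c \<and> b = d"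
  unfolding r_def using quad_repr_unique sqfree D_gt_1 by blast

lemma conj_eq: "\<lbrakk>a \<in> \<rat>; b \<in> \<rat>\<rbrakk> \<Longrightarrow> quad_conj D (a + b * r) = a - b * r"
  unfolding r_def using quad_conj_eq sqfree D_gt_1 by blast

section \<open>Field arithmetic of \<open>K\<close>\<close>

abbreviation K :: "real set" where "K \<equiv> quad_field D"

lemma K_I: "\<lbrakk>a \<in> \<rat>; b \<in> \<rat>\<rbrakk> \<Longrightarrow> a + b * r \<in> K"
  by (auto simp: quad_field_def r_def)

lemma K_E: assumes "x \<in> K" obtains a b where "a \<in> \<rat>" "b \<in> \<rat>" "x = a + b * r"
  using assms by (auto simp: quad_field_def r_def)

lemma K_Rats: "x \<in> \<rat> \<Longrightarrow> x \<in> K" using K_I[of x 0] by simp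

lemma K_add: "\<lbrakk>x \<in> K; y \<in> K\<rbrakk> \<Longrightarrow> x + y \<in> K"
proof (elim K_E)
  fix a b c d assume *: "a \<in> \<rat>" "b \<in> \<rat>" "x = a + b * r" "c \<in> \<rat>" "d \<in> \<rat>" "y = c + d * r"
  have eq: "x + y = (a + c) + (b + d) * r" by (simp add: * algebra_simps)
  show ?thesis unfolding eq using * by (intro K_I) auto
qed

lemma K_mult: "\<lbrakk>x \<in> K; y \<in> K\<rbrakk> \<Longrightarrow> x * y \<in> K"
proof (elim K_E)
  fix a b c d assume *: "a \<in> \<rat>" "b \<in> \<rat>" "x = a + b * r" "c \<in> \<rat>" "d \<in> \<rat>" "y = c + d * r"
  have eq: "x * y = (a * c + b * d * of_int D) + (a * d + b * c) * r"
    unfolding * r_sq[symmetric] by algebra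
  show ?thesis unfolding eq using * by (intro K_I) auto
qed

lemma K_minus: "x \<in> K \<Longrightarrow> - x \<in> K"
  using K_mult[OF K_Rats[of "-1"]] by simp

lemma K_diff: "\<lbrakk>x \<in> K; y \<in> K\<rbrakk> \<Longrightarrow> x - y \<in> K"
  using K_add[OF _ K_minus, of x y] by simp

lemma K_abs: "x \<in> K \<Longrightarrow> \<bar>x\<bar> \<in> K"
  using K_minus by (auto simp: abs_if)

lemma K_inverse: assumes "x \<in> K" shows "inverse x \<in> K"
proof (cases "x = 0")
  case True thus ?thesis using K_Rats[of 0] by simp
next
  case False
  obtain a b where ab: "a \<in> \<rat>" "b \<in> \<rat>" "x = a + b * r" using assms K_E by blast
  define n where "n = a\<^sup>2 - of_int D * b\<^sup>2"
  have n: "n = x * (a - b * r)"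
    unfolding n_def ab r_sq[symmetric] by algebra
  have "a - b * r \<noteq> 0"
    using repr_unique[of a "-b" 0 0] ab False by auto
  with False have "n \<noteq> 0" by (simp add: n)
  have "inverse x = (a - b * r) * inverse n"
    using n \<open>n \<noteq> 0\<close> False by (simp add: field_simps)
  moreover have "inverse n \<in> \<rat>" using ab by (simp add: n_def)
  moreover have "a - b * r \<in> K" using K_I[of a "-b"] ab by simp
  ultimately show ?thesis using K_mult K_Rats by metis
qed

lemma K_divide: "\<lbrakk>x \<in> K; y \<in> K\<rbrakk> \<Longrightarrow> x / y \<in> K"
  unfolding divide_inverse by (intro K_mult K_inverse)

lemma K_power: "x \<in> K \<Longrightarrow> x ^ n \<in> K"
  by (induction n) (auto intro: K_mult K_Rats)

lemma K_power_int: "x \<in> K \<Longrightarrow> x powi n \<in> K"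
  by (auto simp: power_int_def intro: K_power K_inverse)

section \<open>The ring of integers in coordinates\<close>

definition order_sqrt :: "real set" where
  "order_sqrt = {of_int x + of_int y * r | x y. True}"

lemma order_sqrt_I: "of_int x + of_int y * r \<in> order_sqrt"
  by (auto simp: order_sqrt_def)

lemma order_sqrt_of_int: "of_int x \<in> order_sqrt"
  using order_sqrt_I[of x 0] by simp

lemma order_sqrt_add: "\<lbrakk>a \<in> order_sqrt; b \<in> order_sqrt\<rbrakk> \<Longrightarrow> a + b \<in> order_sqrt"
proof -
  assume "a \<in> order_sqrt" "b \<in> order_sqrt"
  then obtain x y z w where *: "a = of_int x + of_int y * r" "b = of_int z + of_int w * r"
    by (auto simp: order_sqrt_def)
  have "a + b = of_int (x + z) + of_int (y + w) * r" by (simp add: * algebra_simps)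
  thus ?thesis using order_sqrt_I by metis
qed

lemma order_sqrt_mult: "\<lbrakk>a \<in> order_sqrt; b \<in> order_sqrt\<rbrakk> \<Longrightarrow> a * b \<in> order_sqrt"
proof -
  assume "a \<in> order_sqrt" "b \<in> order_sqrt"
  then obtain x y z w where *: "a = of_int x + of_int y * r" "b = of_int z + of_int w * r"
    by (auto simp: order_sqrt_def)
  have "a * b = of_int (x * z + y * w * D) + of_int (x * w + y * z) * r"
    unfolding * of_int_add of_int_mult r_sq[symmetric] by algebra
  thus ?thesis using order_sqrt_I by metis
qed

lemma order_sqrt_sum: "(\<And>i. i \<in> A \<Longrightarrow> f i \<in> order_sqrt) \<Longrightarrow> sum f A \<in> order_sqrt"
  using order_sqrt_of_int[of 0]
  by (induction A rule: infinite_finite_induct) (auto intro: order_sqrt_add)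

lemma order_sqrt_power: "a \<in> order_sqrt \<Longrightarrow> a ^ n \<in> order_sqrt"
  using order_sqrt_of_int[of 1] by (induction n) (auto intro: order_sqrt_mult)

lemma K_common_denom:
  assumes "x \<in> K"
  obtains q p1 p2 :: int where "q > 0" "x = (of_int p1 + of_int p2 * r) / of_int q"
proof -
  obtain a b where ab: "a \<in> \<rat>" "b \<in> \<rat>" "x = a + b * r" using assms K_E by blast
  obtain m n where a: "a = of_int m / of_int n" "n > 0" using ab(1) by (metis Rats_cases')
  obtain k l where b: "b = of_int k / of_int l" "l > 0" using ab(2) by (metis Rats_cases')
  have "x = (of_int (m * l) + of_int (k * n) * r) / of_int (n * l)"
    using a b by (simp add: ab field_simps)
  moreover have "n * l > 0" using a b by simp
  ultimately show ?thesis using that by blast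
qed

text \<open>If \<open>q\<close> is a denominator of \<open>\<alpha>\<close> and \<open>d\<close> the
  degree of a monic integral equation for it, \<open>q ^ d\<close> clears the powers up to
  \<open>d\<close>, and the equation expresses each higher power through lower ones.\<close>

lemma algebraic_int_powers_denom:
  assumes "\<alpha> \<in> K" "algebraic_int \<alpha>"
  obtains N :: int where "N > 0" "\<And>i. of_int N * \<alpha> ^ i \<in> order_sqrt"
proof -
  obtain q p1 p2 where q: "q > 0" "\<alpha> = (of_int p1 + of_int p2 * r) / of_int q"
    using assms(1) K_common_denom by blast
  obtain p where p: "lead_coeff p = 1" "\<forall>i. coeff p i \<in> \<int>" "poly p \<alpha> = 0"
    using assms(2) by (auto simp: algebraic_int.simps)
  define d where "d = degree p"
  have top: "\<alpha> ^ d = - (\<Sum>j<d. coeff p j * \<alpha> ^ j)"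
    using p(1,3) by (simp add: poly_altdef d_def lessThan_Suc_atMost[symmetric])
  have "of_int q * \<alpha> = of_int p1 + of_int p2 * r" using q by simp
  hence qa: "of_int q * \<alpha> \<in> order_sqrt" using order_sqrt_I by simp
  have "of_int (q ^ d) * \<alpha> ^ i \<in> order_sqrt" for i
  proof (induction i rule: less_induct)
    case (less i)
    show ?case
    proof (cases "i \<le> d")
      case True
      hence "q ^ d = q ^ (d - i) * q ^ i" by (simp flip: power_add)
      hence "of_int (q ^ d) * \<alpha> ^ i = of_int (q ^ (d - i)) * (of_int q * \<alpha>) ^ i"
        by (simp add: power_mult_distrib)
      thus ?thesis using qa order_sqrt_mult order_sqrt_power order_sqrt_of_int by metis
    next
      case False
      have "\<alpha> ^ i = \<alpha> ^ (i - d) * \<alpha> ^ d" using False by (simp flip: power_add)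
      hence "of_int (q ^ d) * \<alpha> ^ i = (\<Sum>j<d. - coeff p j * (of_int (q ^ d) * \<alpha> ^ (i - d + j)))"
        by (simp add: top sum_distrib_left sum_negf power_add mult_ac)
      also have "\<dots> \<in> order_sqrt"
      proof (rule order_sqrt_sum, rule order_sqrt_mult)
        fix j assume "j \<in> {..<d}"
        show "- coeff p j \<in> order_sqrt" using p(2) order_sqrt_of_int
          by (metis Ints_cases Ints_minus)
        show "of_int (q ^ d) * \<alpha> ^ (i - d + j) \<in> order_sqrt"
          using False \<open>j \<in> {..<d}\<close> by (intro less) auto
      qed
      finally show ?thesis .
    qed
  qed
  moreover have "q ^ d > 0" using q by simp
  ultimately show ?thesis using that by blast
qed

text \<open>Conjugation is multiplicative, so \<open>N * N\<close> times the \<open>i\<close>-th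
  power of the norm is the norm of \<open>N * (a + b * r) ^ i\<close>, an integer. Hence the
  rational norm has powers of bounded denominator.\<close>

lemma norm_Ints_if_powers_denom:
  fixes N :: int
  assumes "a \<in> \<rat>" "b \<in> \<rat>" "N > 0" and int: "\<And>i. of_int N * (a + b * r) ^ i \<in> order_sqrt"
  shows "a\<^sup>2 - of_int D * b\<^sup>2 \<in> \<int>"
proof -
  have pow: "\<exists>c\<in>\<rat>. \<exists>d\<in>\<rat>. (a + b * r) ^ i = c + d * r \<and> (a - b * r) ^ i = c - d * r" for i
  proof (induction i)
    case 0
    show ?case by (intro bexI[of _ 1] bexI[of _ 0]) auto
  next
    case (Suc i)
    then obtain c d where cd: "c \<in> \<rat>" "d \<in> \<rat>" "(a + b * r) ^ i = c + d * r" "(a - b * r) ^ i = c - d * r"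
      by blast
    show ?case
    proof (intro bexI conjI)
      show "(a + b * r) ^ Suc i = (a * c + b * d * of_int D) + (a * d + b * c) * r"
        unfolding power_Suc cd r_sq[symmetric] by algebra
      show "(a - b * r) ^ Suc i = (a * c + b * d * of_int D) - (a * d + b * c) * r"
        unfolding power_Suc cd r_sq[symmetric] by algebra
    qed (use cd assms in auto)
  qed
  have eq: "a\<^sup>2 - of_int D * b\<^sup>2 = (a + b * r) * (a - b * r)"
    unfolding r_sq[symmetric] by algebra
  have "of_int (N * N) * ((a + b * r) * (a - b * r)) ^ i \<in> \<int>" for i
  proof -
    obtain c d where cd: "c \<in> \<rat>" "d \<in> \<rat>" "(a + b * r) ^ i = c + d * r" "(a - b * r) ^ i = c - d * r"
      using pow by blast
    obtain x y where xy: "of_int N * (a + b * r) ^ i = of_int x + of_int y * r"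
      using int[of i] by (auto simp: order_sqrt_def)
    hence "of_int N * c + of_int N * d * r = of_int x + of_int y * r"
      by (simp add: cd algebra_simps)
    hence *: "of_int N * c = of_int x \<and> of_int N * d = of_int y"
      using cd by (intro repr_unique) auto
    have "of_int (N * N) * ((a + b * r) * (a - b * r)) ^ i =
        (of_int N * c + of_int N * d * r) * (of_int N * c - of_int N * d * r)"
      unfolding power_mult_distrib cd of_int_mult by algebra
    also have "\<dots> = of_int (x * x - y * y * D)"
      unfolding conjunct1[OF *] conjunct2[OF *] of_int_diff of_int_mult r_sq[symmetric] by algebra
    finally show ?thesis by simp
  qed
  moreover have "(a + b * r) * (a - b * r) \<in> \<rat>" unfolding eq[symmetric] using assms by simp
  moreover have "N * N > 0" using assms by simp
  ultimately show ?thesis unfolding eq using rat_power_denom_Ints by blast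
qed

text \<open>The pair stands for \<open>(m + n * r) / 2\<close>: its trace \<open>m\<close> is an
  integer anyway, and the condition says that its norm is one too.\<close>

definition half_int :: "int \<Rightarrow> int \<Rightarrow> bool" where
  "half_int m n \<longleftrightarrow> 4 dvd m\<^sup>2 - D * n\<^sup>2"

text \<open>The norms of \<open>\<alpha>\<close> and \<open>\<alpha> + 1\<close> are integers, and
  their difference yields the trace \<open>2 * a\<close>. Squarefreeness of \<open>D\<close> then
  excludes a denominator of \<open>2 * b\<close>.\<close>

lemma quad_ints_half_int:
  assumes "\<alpha> \<in> quad_ints D"
  obtains m n where "half_int m n" "\<alpha> = of_int m / 2 + of_int n / 2 * r"
proof -
  have \<alpha>: "\<alpha> \<in> K" "algebraic_int \<alpha>" using assms by (auto simp: quad_ints_def)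
  obtain a b where ab: "a \<in> \<rat>" "b \<in> \<rat>" "\<alpha> = a + b * r" using \<alpha> K_E by blast
  obtain N where N: "N > 0" "\<And>i. of_int N * \<alpha> ^ i \<in> order_sqrt"
    using algebraic_int_powers_denom[OF \<alpha>] by blast
  have norm: "a\<^sup>2 - of_int D * b\<^sup>2 \<in> \<int>"
    using N ab by (intro norm_Ints_if_powers_denom) auto
  \<comment> \<open>By the binomial theorem the powers of \<open>\<alpha> + 1\<close> have the same
    denominator \<open>N\<close>.\<close>
  have "of_int N * ((a + 1) + b * r) ^ i \<in> order_sqrt" for i
  proof -
    have "of_int N * ((a + 1) + b * r) ^ i = of_int N * (\<alpha> + 1) ^ i" by (simp add: ab add_ac)
    also have "\<dots> = (\<Sum>k\<le>i. of_int (int (i choose k)) * (of_int N * \<alpha> ^ k))"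
      by (simp add: binomial_ring sum_distrib_left mult_ac)
    also have "\<dots> \<in> order_sqrt"
      by (intro order_sqrt_sum order_sqrt_mult order_sqrt_of_int N)
    finally show ?thesis .
  qed
  hence "(a + 1)\<^sup>2 - of_int D * b\<^sup>2 \<in> \<int>"
    using N ab by (intro norm_Ints_if_powers_denom) auto
  from Ints_diff[OF Ints_diff[OF this norm] Ints_1] have "2 * a \<in> \<int>"
    by (simp add: power2_eq_square algebra_simps)
  then obtain m where m: "2 * a = of_int m" by (elim Ints_cases)
  obtain k where k: "a\<^sup>2 - of_int D * b\<^sup>2 = of_int k" using norm by (elim Ints_cases)
  have Db: "of_int D * (2 * b)\<^sup>2 = of_int (m\<^sup>2 - 4 * k)"
    by (simp add: power2_eq_square algebra_simps flip: m k)
  obtain p q where q: "2 * b = of_int p / of_int q" "q > 0" "coprime p q"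
    using ab by (metis Rats_cases' Rats_mult Rats_number_of)
  have "of_int (D * p\<^sup>2) = (of_int ((m\<^sup>2 - 4 * k) * q\<^sup>2) :: real)"
    using Db q(2) unfolding q(1) of_int_mult by (simp add: power_divide field_simps)
  hence eq: "D * p\<^sup>2 = (m\<^sup>2 - 4 * k) * q\<^sup>2" by (simp only: of_int_eq_iff)
  hence "q\<^sup>2 dvd D * p\<^sup>2" by simp
  moreover have "coprime (q\<^sup>2) (p\<^sup>2)" using q(3) by (simp add: coprime_commute)
  ultimately have "q\<^sup>2 dvd D" by (simp add: coprime_dvd_mult_left_iff)
  hence "q dvd 1" using sqfree by (auto simp: squarefree_def)
  hence "q = 1" using q(2) by simp
  hence "m\<^sup>2 - D * p\<^sup>2 = 4 * k" using eq by simp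
  hence "half_int m p" by (simp add: half_int_def)
  moreover have "\<alpha> = of_int m / 2 + of_int p / 2 * r"
    using m q(1) \<open>q = 1\<close> by (simp add: ab flip: m)
  ultimately show ?thesis using that by blast
qed

lemma half_int_quad_ints:
  assumes "half_int m n"
  shows "of_int m / 2 + of_int n / 2 * r \<in> quad_ints D"
proof -
  obtain k where k: "m\<^sup>2 - D * n\<^sup>2 = 4 * k" using assms by (auto simp: half_int_def)
  define \<alpha> where "\<alpha> = of_int m / 2 + of_int n / 2 * r"
  have "(of_int m)\<^sup>2 - of_int D * (of_int n)\<^sup>2 = (4 * of_int k :: real)"
    using arg_cong[OF k, of real_of_int] by simp
  hence "\<alpha> * \<alpha> - of_int m * \<alpha> + of_int k = 0"
    unfolding \<alpha>_def r_sq[symmetric] by (simp add: field_simps power2_eq_square)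
  hence "algebraic_int \<alpha>"
    by (intro algebraic_int.intros[of "[:of_int k, - of_int m, 1:]"])
       (auto simp: algebra_simps coeff_pCons split: nat.split)
  moreover have "\<alpha> \<in> K" unfolding \<alpha>_def by (intro K_I) auto
  ultimately show ?thesis by (simp add: quad_ints_def \<alpha>_def)
qed

section \<open>The lattice in the plane\<close>

abbreviation L :: "(real \<times> real) set" where "L \<equiv> quad_lattice D"

lemma lattice_eq:
  "L = {((of_int m - of_int n * r) / 2, (of_int m + of_int n * r) / 2) | m n. half_int m n}"
proof -
  have *: "quad_embed D (of_int m / 2 + of_int n / 2 * r) =
      ((of_int m - of_int n * r) / 2, (of_int m + of_int n * r) / 2)" for m n
    by (subst quad_embed_def, subst conj_eq) (auto simp: field_simps)
  show ?thesis
  proof (intro equalityI subsetI)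
    fix Q assume "Q \<in> L"
    then obtain \<alpha> where "\<alpha> \<in> quad_ints D" "Q = quad_embed D \<alpha>" by (auto simp: quad_lattice_def)
    moreover obtain m n where "half_int m n" "\<alpha> = of_int m / 2 + of_int n / 2 * r"
      using calculation(1) by (rule quad_ints_half_int)
    ultimately show "Q \<in> {((of_int m - of_int n * r) / 2, (of_int m + of_int n * r) / 2) | m n. half_int m n}"
      using * by blast
  next
    fix Q assume "Q \<in> {((of_int m - of_int n * r) / 2, (of_int m + of_int n * r) / 2) | m n. half_int m n}"
    then obtain m n where "half_int m n" "Q = quad_embed D (of_int m / 2 + of_int n / 2 * r)"
      using * by auto
    thus "Q \<in> L" using half_int_quad_ints by (auto simp: quad_lattice_def)
  qed
qed

lemma D_mod_4: "D mod 4 \<noteq> 0"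
proof
  assume "D mod 4 = 0"
  hence "2\<^sup>2 dvd D" by (simp add: dvd_eq_mod_eq_0)
  hence "(2::int) dvd 1" using sqfree unfolding squarefree_def by blast
  thus False by simp
qed

text \<open>Squares are 0 or 1 modulo 4, and \<open>D mod 4\<close> is not 0 as \<open>D\<close> is
  squarefree. From the parity condition, closure under addition can be read off.\<close>

lemma half_int_iff:
  "half_int m n \<longleftrightarrow> even m \<and> even n \<or> D mod 4 = 1 \<and> odd m \<and> odd n"
proof -
  have sq: "x\<^sup>2 mod 4 = (if even x then 0 else 1)" for x :: int
  proof (cases "even x")
    case True
    then obtain y where "x = 2 * y" by blast
    thus ?thesis by (simp add: power2_eq_square)
  next
    case False
    then obtain y where "x = 2 * y + 1" by (elim oddE)
    hence "x\<^sup>2 = 1 + 4 * (y * y + y)" by (simp add: power2_eq_square algebra_simps)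
    thus ?thesis using False by presburger
  qed
  have "(m\<^sup>2 - D * n\<^sup>2) mod 4 = (m\<^sup>2 mod 4 - (D mod 4) * (n\<^sup>2 mod 4)) mod 4"
    by (rule mod_diff_cong) (simp_all add: mod_mult_eq)
  hence *: "half_int m n \<longleftrightarrow>
      ((if even m then 0 else 1) - (D mod 4) * (if even n then 0 else 1)) mod 4 = 0"
    by (simp only: half_int_def dvd_eq_mod_eq_0[of 4] sq)
  have "0 \<le> D mod 4" "D mod 4 < 4" by simp_all
  with D_mod_4 consider "D mod 4 = 1" | "D mod 4 = 2" | "D mod 4 = 3" by linarith
  thus ?thesis unfolding * by cases auto
qed

lemma lattice_I:
  "half_int m n \<Longrightarrow> s = (of_int m - of_int n * r) / 2 \<Longrightarrow> u = (of_int m + of_int n * r) / 2 \<Longrightarrow> (s, u) \<in> L"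
  by (auto simp: lattice_eq)

lemma lattice_E:
  assumes "Q \<in> L"
  obtains m n where "half_int m n" "Q = ((of_int m - of_int n * r) / 2, (of_int m + of_int n * r) / 2)"
  using assms by (auto simp: lattice_eq)

lemma lattice_add: assumes "P \<in> L" "Q \<in> L" shows "P + Q \<in> L"
proof -
  obtain m n where P: "half_int m n" "P = ((of_int m - of_int n * r) / 2, (of_int m + of_int n * r) / 2)"
    using assms lattice_E by blast
  obtain k l where Q: "half_int k l" "Q = ((of_int k - of_int l * r) / 2, (of_int k + of_int l * r) / 2)"
    using assms lattice_E by blast
  show ?thesis unfolding P(2) Q(2) add_Pair
    by (rule lattice_I[of "m + k" "n + l"]) (use P Q in \<open>auto simp: half_int_iff field_simps\<close>)
qed

lemma lattice_minus: assumes "P \<in> L" shows "- P \<in> L"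
proof -
  obtain m n where P: "half_int m n" "P = ((of_int m - of_int n * r) / 2, (of_int m + of_int n * r) / 2)"
    using assms lattice_E by blast
  show ?thesis unfolding P(2) uminus_Pair
    by (rule lattice_I[of "- m" "- n"]) (use P in \<open>auto simp: half_int_def field_simps\<close>)
qed

lemma lattice_diff: "\<lbrakk>P \<in> L; Q \<in> L\<rbrakk> \<Longrightarrow> P - Q \<in> L"
  using lattice_add[OF _ lattice_minus, of P Q] by simp

lemma lattice_0: "0 \<in> L"
  unfolding zero_prod_def by (rule lattice_I[of 0 0]) (auto simp: half_int_def)

text \<open>Swapping the coordinates is Galois conjugation. The swap reverses the unit action, so
  results on forward orbits also serve backward ones.\<close>

lemma lattice_swap: assumes "P \<in> L" shows "prod.swap P \<in> L"
proof -
  obtain m n where P: "half_int m n" "P = ((of_int m - of_int n * r) / 2, (of_int m + of_int n * r) / 2)"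
    using assms lattice_E by blast
  show ?thesis unfolding P(2) swap_simp
    by (rule lattice_I[of m "- n"]) (use P in \<open>auto simp: half_int_def\<close>)
qed

text \<open>The norm is multiplicative, so multiplication by a Pell solution preserves the
  divisibility by 4 behind \<open>half_int\<close>.\<close>

lemma lattice_unit_mult:
  assumes "(s, t) \<in> L" "x\<^sup>2 - D * y\<^sup>2 = 1"
  shows "(s * (of_int x - of_int y * r), t * (of_int x + of_int y * r)) \<in> L"
proof -
  obtain m n where P: "half_int m n" "s = (of_int m - of_int n * r) / 2" "t = (of_int m + of_int n * r) / 2"
    using assms lattice_E by blast
  show ?thesis
  proof (rule lattice_I[of "m * x + D * n * y" "m * y + n * x"])
    have "(m * x + D * n * y)\<^sup>2 - D * (m * y + n * x)\<^sup>2 = (m\<^sup>2 - D * n\<^sup>2) * (x\<^sup>2 - D * y\<^sup>2)"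
      by algebra
    thus "half_int (m * x + D * n * y) (m * y + n * x)" using P assms by (simp add: half_int_def)
  next
    show "s * (of_int x - of_int y * r) = (of_int (m * x + D * n * y) - of_int (m * y + n * x) * r) / 2"
      unfolding P of_int_add of_int_mult r_sq[symmetric] by (simp add: field_simps del: r_sq)
    show "t * (of_int x + of_int y * r) = (of_int (m * x + D * n * y) + of_int (m * y + n * x) * r) / 2"
      unfolding P of_int_add of_int_mult r_sq[symmetric] by (simp add: field_simps del: r_sq)
  qed
qed

lemma lattice_in_K: assumes "(s, t) \<in> L" shows "s \<in> K" "t \<in> K"
proof -
  obtain m n where P: "half_int m n" "s = (of_int m - of_int n * r) / 2" "t = (of_int m + of_int n * r) / 2"
    using assms lattice_E by blast
  show "s \<in> K" "t \<in> K" using K_I[of "of_int m / 2" "- of_int n / 2"] K_I[of "of_int m / 2" "of_int n / 2"]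
    by (simp_all add: P diff_divide_distrib add_divide_distrib)
qed

text \<open>The sublattice from Z[sqrt D] is enough: rounding down the coordinates with respect to 1
  and \<open>sqrt D\<close> leaves the remainders \<open>f - g * r\<close> and
  \<open>f + g * r\<close> with fractional parts \<open>f\<close> and \<open>g\<close>.\<close>

lemma lattice_covering:
  "\<exists>Q\<in>L. \<bar>fst (P - Q)\<bar> \<le> 1 + r \<and> \<bar>snd (P - Q)\<bar> \<le> 1 + r"
proof -
  obtain s u where P: "P = (s, u)" by fastforce
  define p where "p = \<lfloor>(s + u) / 2\<rfloor>"
  define q where "q = \<lfloor>(u - s) / (2 * r)\<rfloor>"
  define f where "f = (s + u) / 2 - of_int p"
  define g where "g = (u - s) / (2 * r) - of_int q"
  have f: "0 \<le> f" "f \<le> 1" unfolding f_def p_def by linarith+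
  have g: "0 \<le> g" "g \<le> 1" unfolding g_def q_def by linarith+
  have s: "s = of_int p + f - (of_int q + g) * r" and u: "u = of_int p + f + (of_int q + g) * r"
    using r_pos by (simp_all add: f_def g_def field_simps)
  have gr: "0 \<le> g * r" "g * r \<le> r" using g r_pos mult_right_mono[of g 1 r] by auto
  have "(of_int p - of_int q * r, of_int p + of_int q * r) \<in> L"
    by (rule lattice_I[of "2 * p" "2 * q"]) (auto simp: half_int_iff)
  moreover have "\<bar>s - (of_int p - of_int q * r)\<bar> \<le> 1 + r" "\<bar>u - (of_int p + of_int q * r)\<bar> \<le> 1 + r"
    using f gr by (auto simp: s u algebra_simps)
  ultimately show ?thesis unfolding P by force
qed

lemma finite_lattice_box: "finite {Q \<in> L. \<bar>fst Q\<bar> \<le> B \<and> \<bar>snd Q\<bar> \<le> B}"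
proof (rule finite_subset)
  let ?g = "\<lambda>(m, n). ((of_int m - of_int n * r) / 2, (of_int m + of_int n * r) / 2)"
  let ?I = "{- \<lceil>2 * B\<rceil>..\<lceil>2 * B\<rceil>}"
  have r1: "r \<ge> 1" using D_gt_1 by (simp add: r_def)
  show "{Q \<in> L. \<bar>fst Q\<bar> \<le> B \<and> \<bar>snd Q\<bar> \<le> B} \<subseteq> ?g ` (?I \<times> ?I)"
  proof
    fix Q assume Q: "Q \<in> {Q \<in> L. \<bar>fst Q\<bar> \<le> B \<and> \<bar>snd Q\<bar> \<le> B}"
    then obtain m n where mn: "Q = ((of_int m - of_int n * r) / 2, (of_int m + of_int n * r) / 2)"
      using lattice_E by blast
    have "\<bar>real_of_int m\<bar> \<le> 2 * B" "\<bar>of_int n * r\<bar> \<le> 2 * B" using Q by (auto simp: mn)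
    moreover have "\<bar>real_of_int n\<bar> \<le> \<bar>of_int n * r\<bar>"
      using r1 mult_left_mono[of 1 r "\<bar>real_of_int n\<bar>"] by (simp add: abs_mult)
    ultimately have "m \<in> ?I" "n \<in> ?I" by (auto; linarith)+
    thus "Q \<in> ?g ` (?I \<times> ?I)" using mn by force
  qed
qed simp

text \<open>The second basis element is \<open>(1 + sqrt D) / 2\<close> if
  \<open>D mod 4 = 1\<close> and \<open>sqrt D\<close> otherwise; \<open>k\<close> and
  \<open>c\<close> encode both cases. The condition \<open>b \<noteq> 0\<close> makes the embedded
  basis independent over the reals.\<close>

lemma int_basis_exists: "\<exists>w. is_int_basis D 1 w \<and> (\<exists>a b. quad_embed D w = (a - b * r, a + b * r) \<and> b \<noteq> 0)"
proof -
  define c :: int where "c = (if D mod 4 = 1 then 1 else 2)"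
  define k :: int where "k = (if D mod 4 = 1 then 1 else 0)"
  define w where "w = of_int k / 2 + of_int c / 2 * r"
  have kc: "half_int k c" by (auto simp: half_int_iff k_def c_def)
  have c0: "c \<noteq> 0" by (simp add: c_def)
  have "is_int_basis D 1 w"
    unfolding is_int_basis_def
  proof (intro conjI ballI)
    show "1 \<in> quad_ints D" using half_int_quad_ints[of 2 0] by (simp add: half_int_iff)
    show "w \<in> quad_ints D" unfolding w_def using half_int_quad_ints[OF kc] .
    fix a assume "a \<in> quad_ints D"
    then obtain m n where mn: "half_int m n" "a = of_int m / 2 + of_int n / 2 * r"
      by (rule quad_ints_half_int)
    have "c dvd n" "2 dvd m - k * (n div c)" using mn(1) by (auto simp: half_int_iff c_def k_def)
    then obtain y x where y: "n = c * y" and x: "m - k * (n div c) = 2 * x" unfolding dvd_def by blast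
    have x: "m - k * y = 2 * x" using x y c0 by simp
    have mk: "real_of_int m = 2 * of_int x + of_int k * of_int y"
      using arg_cong[OF x, of real_of_int] by simp
    show "\<exists>!(x::int, y::int). a = of_int x * 1 + of_int y * w"
    proof (rule ex1I[of _ "(x, y)"])
      show "case (x, y) of (x, y) \<Rightarrow> a = of_int x * 1 + of_int y * w"
        using mk by (simp add: mn(2) w_def y field_simps)
      fix z :: "int \<times> int" assume z: "case z of (x, y) \<Rightarrow> a = of_int x * 1 + of_int y * w"
      obtain x' y' where z': "z = (x', y')" by fastforce
      have "(of_int x' + of_int y' * of_int k / 2) + (of_int y' * of_int c / 2) * r
          = of_int m / 2 + (of_int n / 2) * r"
        using z unfolding z' w_def mn(2) by (simp add: algebra_simps)
      hence "of_int x' + of_int y' * of_int k / 2 = of_int m / (2 :: real) \<and>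
          of_int y' * of_int c / 2 = of_int n / (2 :: real)"
        by (intro repr_unique) auto
      hence "real_of_int y' = of_int y" "real_of_int x' = of_int x"
        using mk c0 by (auto simp: y field_simps)
      thus "z = (x, y)" by (simp add: z')
    qed
  qed
  moreover have "quad_embed D w = (of_int k / 2 - of_int c / 2 * r, of_int k / 2 + of_int c / 2 * r)"
    unfolding w_def quad_embed_def by (subst conj_eq) auto
  moreover have "of_int c / 2 \<noteq> (0 :: real)" using c0 by simp
  ultimately show ?thesis by blast
qed

subsection \<open>Pell units and their action\<close>

text \<open>Dirichlet's approximations \<open>h / k\<close> to \<open>sqrt D\<close> give infinitely
  many pairs of bounded norm \<open>h\<^sup>2 - D * k\<^sup>2\<close>. Two of them share the norm
  and the residues modulo it, so their quotient is integral of norm 1.\<close>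

lemma pell_ex: obtains x y :: int where "x > 0" "y > 0" "x\<^sup>2 - D * y\<^sup>2 = 1"
proof -
  define S where "S = approx_set r"
  define nrm where "nrm = (\<lambda>(h, k). h\<^sup>2 - D * k\<^sup>2 :: int)"
  define f where "f = (\<lambda>z. (nrm z, fst z mod nrm z, snd z mod nrm z))"
  define B where "B = \<lceil>2 * r + 1\<rceil>"
  have inf: "infinite S"
    using r_irrat rational_iff_finite_approx_set S_def by blast
  have SE: "k > 0 \<and> coprime h k \<and> nrm (h, k) \<noteq> 0 \<and> \<bar>nrm (h, k)\<bar> \<le> B" if "(h, k) \<in> S" for h k
  proof -
    have k: "k > 0" "coprime h k" and a: "\<bar>r - of_int h / of_int k\<bar> < 1 / (of_int k)\<^sup>2"
      using that by (auto simp: S_def approx_set_def)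
    \<comment> \<open>The norm factors as \<open>t * (t + 2 * k * r)\<close>, and the approximation
      gives \<open>\<bar>t\<bar> < 1 / k\<close>.\<close>
    define t where "t = of_int h - of_int k * r"
    have "\<bar>t\<bar> = of_int k * \<bar>r - of_int h / of_int k\<bar>"
      using k by (simp add: t_def abs_if field_simps)
    also have "\<dots> < of_int k * (1 / (of_int k)\<^sup>2)"
      using a k by (intro mult_strict_left_mono) auto
    also have "\<dots> = 1 / of_int k" using k by (simp add: power2_eq_square)
    finally have t: "\<bar>t\<bar> * of_int k < 1" using k by (simp add: field_simps)
    have k1: "real_of_int k \<ge> 1" using k by simp
    have "\<bar>t\<bar> * 1 \<le> \<bar>t\<bar> * of_int k" using k1 by (intro mult_left_mono) auto
    hence t1: "\<bar>t\<bar> < 1" using t by linarith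
    have "of_int (nrm (h, k)) = t * (t + 2 * of_int k * r)"
      unfolding nrm_def t_def prod.case of_int_diff of_int_mult of_int_power r_sq[symmetric] by algebra
    hence n: "of_int \<bar>nrm (h, k)\<bar> = \<bar>t\<bar> * \<bar>t + 2 * of_int k * r\<bar>" by (simp add: abs_mult)
    also have "\<dots> \<le> \<bar>t\<bar> * (\<bar>t\<bar> + 2 * of_int k * r)"
      using r_pos k by (intro mult_left_mono) (auto intro: order_trans[OF abs_triangle_ineq])
    also have "\<dots> = \<bar>t\<bar> * \<bar>t\<bar> + (\<bar>t\<bar> * of_int k) * (2 * r)" by (simp add: algebra_simps)
    also have "\<bar>t\<bar> * \<bar>t\<bar> \<le> 1" using t1 by (intro mult_le_one) auto
    also have "(\<bar>t\<bar> * of_int k) * (2 * r) \<le> 1 * (2 * r)"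
      using t r_pos by (intro mult_right_mono) auto
    finally have "real_of_int \<bar>nrm (h, k)\<bar> \<le> 2 * r + 1" by simp
    hence "\<bar>nrm (h, k)\<bar> \<le> B" unfolding B_def by linarith
    moreover have "nrm (h, k) \<noteq> 0"
    proof
      assume "nrm (h, k) = 0"
      hence "h\<^sup>2 = D * k\<^sup>2" by (simp add: nrm_def)
      hence "k\<^sup>2 dvd h\<^sup>2" by simp
      hence "k dvd h" by simp
      hence "k = 1" using k by (metis coprime_absorb_right zdvd1_eq abs_of_pos)
      hence "h\<^sup>2 = D" using \<open>h\<^sup>2 = D * k\<^sup>2\<close> by simp
      hence "h dvd 1" using sqfree by (auto simp: squarefree_def)
      hence "h\<^sup>2 = 1" by (auto simp: power2_eq_1_iff)
      thus False using \<open>h\<^sup>2 = D\<close> D_gt_1 by simp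
    qed
    ultimately show ?thesis using k by blast
  qed
  have "f ` S \<subseteq> {-B..B} \<times> {-B..B} \<times> {-B..B}"
  proof
    fix w assume "w \<in> f ` S"
    then obtain h k where hk: "(h, k) \<in> S" "w = f (h, k)" by auto
    have "\<bar>z mod c\<bar> \<le> \<bar>c\<bar>" if "c \<noteq> 0" for z c :: int using that abs_mod_less[of c z] by simp
    from this[of "nrm (h, k)" h] this[of "nrm (h, k)" k] SE[OF hk(1)]
    show "w \<in> {-B..B} \<times> {-B..B} \<times> {-B..B}" by (auto simp: hk f_def)
  qed
  hence "finite (f ` S)" by (rule finite_subset) simp
  with inf obtain z1 where z1: "z1 \<in> S" "infinite {z \<in> S. f z = f z1}"
    using pigeonhole_infinite by blast
  have "infinite ({z \<in> S. f z = f z1} - {z1})" using z1 by simp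
  hence "{z \<in> S. f z = f z1} - {z1} \<noteq> {}" by (rule infinite_imp_nonempty)
  then obtain z2 where z2: "z2 \<in> S" "f z2 = f z1" "z2 \<noteq> z1" by blast
  obtain h1 k1 h2 k2 where z: "z1 = (h1, k1)" "z2 = (h2, k2)" by fastforce
  define N where "N = nrm (h1, k1)"
  have N: "h1\<^sup>2 - D * k1\<^sup>2 = N" "h2\<^sup>2 - D * k2\<^sup>2 = N" "h2 mod N = h1 mod N" "k2 mod N = k1 mod N"
    using z2(2) by (auto simp: z N_def f_def nrm_def)
  have N0: "N \<noteq> 0" using SE z1 unfolding z N_def by blast
  obtain a where a: "h2 = h1 + N * a" using N(3) by (metis mod_eqE)
  obtain b where b: "k2 = k1 + N * b" using N(4) by (metis mod_eqE)
  \<comment> \<open>\<open>x + y * r\<close> is the quotient of \<open>h1 + k1 * r\<close> by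
    \<open>h2 + k2 * r\<close>; the congruences modulo \<open>N\<close> make it integral.\<close>
  define x where "x = 1 + h1 * a - D * k1 * b"
  define y where "y = k1 * a - h1 * b"
  have xN: "N * x = h1 * h2 - D * k1 * k2" unfolding x_def a b N(1)[symmetric] by algebra
  have yN: "N * y = k1 * h2 - h1 * k2" unfolding y_def a b by algebra
  have "(N * x)\<^sup>2 - D * (N * y)\<^sup>2 = (h1\<^sup>2 - D * k1\<^sup>2) * (h2\<^sup>2 - D * k2\<^sup>2)"
    unfolding xN yN by algebra
  hence "N\<^sup>2 * (x\<^sup>2 - D * y\<^sup>2) = N\<^sup>2 * 1"
    unfolding N by (simp add: power_mult_distrib algebra_simps power2_eq_square)
  hence pell: "x\<^sup>2 - D * y\<^sup>2 = 1" using N0 by simp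
  \<comment> \<open>If \<open>y = 0\<close>, the fractions \<open>h1 / k1\<close> and
    \<open>h2 / k2\<close> agree and, being in lowest terms, come from the same pair.\<close>
  have y0: "y \<noteq> 0"
  proof
    assume "y = 0"
    hence eq: "k1 * h2 = h1 * k2" using yN by simp
    have c: "k1 > 0" "coprime h1 k1" "k2 > 0" "coprime h2 k2" using SE z1 z2 by (auto simp: z)
    have "k1 dvd k2" using eq c by (metis dvd_triv_left coprime_commute coprime_dvd_mult_right_iff)
    moreover have "k2 dvd k1" using eq c by (metis dvd_triv_right coprime_commute coprime_dvd_mult_left_iff)
    ultimately have "k1 = k2" using c by (simp add: zdvd_antisym_nonneg)
    thus False using eq c z2(3) by (simp add: z)
  qed
  have x0: "x \<noteq> 0"
  proof
    assume "x = 0"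
    hence "D * y\<^sup>2 = -1" using pell by simp
    moreover have "D * y\<^sup>2 \<ge> 0" using D_gt_1 by simp
    ultimately show False by simp
  qed
  show ?thesis using that[of "\<bar>x\<bar>" "\<bar>y\<bar>"] x0 y0 pell by simp
qed

end

text \<open>Norm 1 makes the conjugate of \<open>e\<close> its inverse, and positive
  \<open>x\<close> and \<open>y\<close> give \<open>e > 1\<close>.\<close>

locale real_quadratic_unit = real_quadratic +
  fixes e :: real
  assumes e_unit: "\<exists>x y. x > 0 \<and> y > 0 \<and> x\<^sup>2 - D * y\<^sup>2 = 1 \<and> e = of_int x + of_int y * r"
begin

lemma e_gt_1: "e > 1"
proof -
  obtain x y where xy: "x > 0" "y > 0" "e = of_int x + of_int y * r" using e_unit by blast
  have "real_of_int x \<ge> 1" "of_int y * r > 0" using xy r_pos by auto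
  thus ?thesis using xy by linarith
qed

lemma e_pos [simp]: "e > 0" and e_nz [simp]: "e \<noteq> 0"
  using e_gt_1 by auto

lemma e_powi_pos [simp]: "e powi k > 0"
  by (simp add: zero_less_power_int)

lemma e_powi_nonneg [simp]: "e powi k \<ge> 0"
  by (rule less_imp_le) simp

lemma abs_e_powi [simp]: "\<bar>e powi k\<bar> = e powi k"
  by simp

lemma e_K: "e \<in> K"
  using e_unit K_I by (metis Rats_of_int)

text \<open>Multiplication by the \<open>k\<close>-th power of the unit, whose conjugate has the
  opposite exponent; negative \<open>k\<close> follows orbits backward.\<close>

definition act :: "int \<Rightarrow> real \<times> real \<Rightarrow> real \<times> real" where
  "act k P = (fst P * e powi (- k), snd P * e powi k)"

lemma fst_act: "fst (act k P) = fst P * e powi (- k)"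
  and snd_act: "snd (act k P) = snd P * e powi k"
  by (simp_all add: act_def)

lemma act_0 [simp]: "act 0 P = P"
  by (simp add: act_def)

lemma act_add: "act k (P + Q) = act k P + act k Q"
  and act_diff: "act k (P - Q) = act k P - act k Q"
  by (auto simp: act_def algebra_simps)

lemma act_act: "act j (act k P) = act (j + k) P"
proof -
  have "e powi (- (j + k)) = e powi (- k) * e powi (- j)" "e powi (j + k) = e powi k * e powi j"
    by (simp_all flip: power_int_add add: add.commute)
  thus ?thesis by (simp only: act_def fst_conv snd_conv mult.assoc)
qed

lemma act_1_lattice:
  assumes "Q \<in> L"
  shows "act 1 Q \<in> L" "act (-1) Q \<in> L"
proof -
  obtain x y where xy: "x\<^sup>2 - D * y\<^sup>2 = 1" "e = of_int x + of_int y * r" using e_unit by blast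
  obtain s t where Q: "Q = (s, t)" by fastforce
  have "e * (of_int x - of_int y * r) = of_int (x\<^sup>2 - D * y\<^sup>2)"
    unfolding xy(2) of_int_diff of_int_mult of_int_power r_sq[symmetric] by algebra
  hence e': "inverse e = of_int x - of_int y * r"
    using xy(1) by (simp add: field_simps)
  show "act 1 Q \<in> L"
    using lattice_unit_mult[OF _ xy(1), of s t] assms
    unfolding xy(2)[symmetric] e'[symmetric] by (simp add: act_def Q power_int_minus)
  show "act (-1) Q \<in> L"
    using lattice_unit_mult[of s t x "- y"] assms xy(1)
    unfolding of_int_minus mult_minus_left diff_minus_eq_add add_uminus_conv_diff
      xy(2)[symmetric] e'[symmetric] by (simp add: act_def Q power_int_minus)
qed

lemma act_lattice: "Q \<in> L \<Longrightarrow> act k Q \<in> L"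
proof (induction k rule: int_induct[of _ 0])
  case (step1 i)
  thus ?case using act_1_lattice(1) by (metis act_act add.commute)
next
  case (step2 i)
  thus ?case using act_1_lattice(2) by (metis act_act uminus_add_conv_diff)
qed auto

lemma abs_norm_act [simp]: "abs_norm (act k P) = abs_norm P"
  by (simp add: abs_norm_def act_def power_int_minus abs_mult)

lemma powi_normalize:
  assumes "x > 0"
  obtains k where "1 \<le> x * e powi k" "x * e powi k \<le> e"
proof -
  define k where "k = - \<lfloor>log e x\<rfloor>"
  have "x * e powi k = e powr (log e x + of_int k)"
    using assms e_gt_1 by (simp add: powr_add powr_real_of_int')
  moreover have "0 \<le> log e x + of_int k" "log e x + of_int k \<le> 1" unfolding k_def by linarith+
  hence "1 \<le> e powr (log e x + of_int k)" "e powr (log e x + of_int k) \<le> e"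
    using e_gt_1 powr_mono[of _ 1 e] by (auto intro: ge_one_powr_ge_zero)
  ultimately show ?thesis using that by metis
qed

text \<open>Scaling a nonzero coordinate into the interval from 1 to \<open>e\<close> bounds the
  other one by the product, hence by \<open>C\<close>. The box depends on \<open>C\<close> and
  \<open>e\<close> alone, which makes later estimates uniform along orbits.\<close>

lemma act_into_box:
  assumes "abs_norm P \<le> C"
  obtains k where "\<bar>fst (act k P)\<bar> \<le> C + e" "\<bar>snd (act k P)\<bar> \<le> C + e"
proof -
  obtain s u where P: "P = (s, u)" by fastforce
  have su: "\<bar>s\<bar> * \<bar>u\<bar> \<le> C" using assms by (simp add: abs_norm_def abs_mult P)
  have C0: "C \<ge> 0" using assms abs_ge_zero unfolding abs_norm_def by (rule order_trans[rotated])
  consider "u \<noteq> 0" | "u = 0" "s \<noteq> 0" | "u = 0" "s = 0" by blast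
  thus ?thesis
  proof cases
    case 1
    then obtain k where k: "1 \<le> \<bar>u\<bar> * e powi k" "\<bar>u\<bar> * e powi k \<le> e"
      using powi_normalize[of "\<bar>u\<bar>"] by auto
    have "\<bar>fst (act k P)\<bar> * 1 \<le> \<bar>fst (act k P)\<bar> * (\<bar>u\<bar> * e powi k)"
      using k by (intro mult_left_mono) auto
    also have "\<dots> = \<bar>s\<bar> * \<bar>u\<bar>"
      by (simp add: P fst_act power_int_minus abs_mult)
    finally show ?thesis using that[of k] k su C0 e_pos by (simp add: P snd_act abs_mult)
  next
    case 2
    then obtain k where k: "1 \<le> \<bar>s\<bar> * e powi k" "\<bar>s\<bar> * e powi k \<le> e"
      using powi_normalize[of "\<bar>s\<bar>"] by auto
    thus ?thesis using that[of "- k"] 2 C0 e_gt_1 by (simp add: P fst_act snd_act abs_mult)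
  next
    case 3
    thus ?thesis using that[of 0] C0 e_gt_1 by (simp add: P)
  qed
qed

end

subsection \<open>The inhomogeneous minimum function\<close>

definition within_box :: "real \<Rightarrow> real \<times> real \<Rightarrow> bool" where
  "within_box \<eta> P \<longleftrightarrow> \<bar>fst P\<bar> \<le> \<eta> \<and> \<bar>snd P\<bar> \<le> \<eta>"

text \<open>Expanding the product bounds the change of the norm on a box;
  \<open>\<eta> \<le> 1\<close> makes the quadratic error term linear.\<close>

lemma abs_norm_perturb:
  assumes w: "within_box B w" and d: "within_box \<eta> d" and \<eta>: "\<eta> \<le> 1"
  shows "abs_norm (w + d) \<le> abs_norm w + (2 * B + 1) * \<eta>"
proof -
  obtain a b x y where eq: "w = (a, b)" "d = (x, y)" by fastforce
  have le: "\<bar>a\<bar> \<le> B" "\<bar>b\<bar> \<le> B" "\<bar>x\<bar> \<le> \<eta>" "\<bar>y\<bar> \<le> \<eta>"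
    using w d by (auto simp: within_box_def eq)
  have "(a + x) * (b + y) = a * b + (a * y + x * b + x * y)" by algebra
  hence "abs_norm (w + d) \<le> \<bar>a * b\<bar> + (\<bar>a\<bar> * \<bar>y\<bar> + \<bar>x\<bar> * \<bar>b\<bar> + \<bar>x\<bar> * \<bar>y\<bar>)"
    unfolding abs_norm_def eq by (simp flip: abs_mult)
  also have "\<bar>a\<bar> * \<bar>y\<bar> \<le> B * \<eta>" using le by (intro mult_mono) auto
  also have "\<bar>x\<bar> * \<bar>b\<bar> \<le> \<eta> * B" using le by (intro mult_mono) auto
  also have "\<bar>x\<bar> * \<bar>y\<bar> \<le> \<eta> * 1" using le \<eta> by (intro mult_mono) auto
  finally show ?thesis by (simp add: abs_norm_def eq algebra_simps)
qed

context real_quadratic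
begin

lemma inhom_M_le: "Q \<in> L \<Longrightarrow> inhom_M D P \<le> abs_norm (P - Q)"
  unfolding inhom_M_def by (rule cINF_lower) (auto intro!: bdd_belowI[of _ 0] simp: abs_norm_def)

lemma inhom_M_ge: "(\<And>Q. Q \<in> L \<Longrightarrow> c \<le> abs_norm (P - Q)) \<Longrightarrow> c \<le> inhom_M D P"
  unfolding inhom_M_def using lattice_0 by (intro cINF_greatest) auto

lemma inhom_M_nonneg: "inhom_M D P \<ge> 0"
  by (rule inhom_M_ge) (simp add: abs_norm_def)

lemma inhom_M_lessE:
  assumes "inhom_M D P < c" obtains Q where "Q \<in> L" "abs_norm (P - Q) < c"
  using assms inhom_M_ge[of c P] by (meson not_less)

lemma inhom_M_0: "inhom_M D 0 = 0"
  using inhom_M_le[OF lattice_0, of 0] inhom_M_nonneg[of 0] by (simp add: abs_norm_def)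

lemma inhom_M_bounded: "inhom_M D P \<le> (1 + r) * (1 + r)"
proof -
  obtain Q where Q: "Q \<in> L" "\<bar>fst (P - Q)\<bar> \<le> 1 + r" "\<bar>snd (P - Q)\<bar> \<le> 1 + r"
    using lattice_covering by blast
  have "abs_norm (P - Q) \<le> (1 + r) * (1 + r)"
    unfolding abs_norm_def abs_mult using Q r_pos by (intro mult_mono) auto
  thus ?thesis using inhom_M_le[OF Q(1), of P] by simp
qed

lemma inhom_M_add_lattice: assumes "Q \<in> L" shows "inhom_M D (P + Q) = inhom_M D P"
proof -
  have le: "inhom_M D P \<le> inhom_M D (P + Q)" if "Q \<in> L" for P Q
  proof (rule inhom_M_ge)
    fix R assume "R \<in> L"
    hence "inhom_M D P \<le> abs_norm (P - (R - Q))" using that by (intro inhom_M_le lattice_diff)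
    thus "inhom_M D P \<le> abs_norm (P + Q - R)" by (simp add: algebra_simps)
  qed
  show ?thesis using le[OF assms, of P] le[OF lattice_minus[OF assms], of "P + Q"] by simp
qed

text \<open>A lattice point that is nearly optimal for \<open>P\<close> serves every nearby
  \<open>P'\<close>. The opposite estimate is not local and comes from shadowing.\<close>

lemma inhom_M_upper_semicontinuous:
  assumes "\<delta> > 0"
  obtains \<eta> where "\<eta> > 0" "\<And>P'. within_box \<eta> (P' - P) \<Longrightarrow> inhom_M D P' \<le> inhom_M D P + \<delta>"
proof -
  obtain Q where Q: "Q \<in> L" "abs_norm (P - Q) < inhom_M D P + \<delta> / 2"
    using inhom_M_lessE[of P "inhom_M D P + \<delta> / 2"] assms by auto
  define B where "B = max \<bar>fst (P - Q)\<bar> \<bar>snd (P - Q)\<bar>"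
  have B: "within_box B (P - Q)" "B \<ge> 0" by (auto simp: within_box_def B_def)
  define \<eta> where "\<eta> = min 1 (\<delta> / 2 / (2 * B + 1))"
  have \<eta>: "\<eta> > 0" "\<eta> \<le> 1" "(2 * B + 1) * \<eta> \<le> \<delta> / 2"
  proof -
    show "\<eta> > 0" "\<eta> \<le> 1" using B(2) assms by (simp_all add: \<eta>_def)
    have "\<eta> \<le> \<delta> / 2 / (2 * B + 1)" by (simp add: \<eta>_def)
    thus "(2 * B + 1) * \<eta> \<le> \<delta> / 2" using B(2) by (simp add: pos_le_divide_eq algebra_simps)
  qed
  show ?thesis
  proof (rule that[OF \<eta>(1)])
    fix P' assume "within_box \<eta> (P' - P)"
    hence "abs_norm ((P - Q) + (P' - P)) \<le> abs_norm (P - Q) + (2 * B + 1) * \<eta>"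
      using B \<eta> by (intro abs_norm_perturb) auto
    moreover have "inhom_M D P' \<le> abs_norm (P' - Q)" using Q by (intro inhom_M_le)
    ultimately show "inhom_M D P' \<le> inhom_M D P + \<delta>" using Q \<eta> by (simp add: algebra_simps)
  qed
qed

section \<open>Passage to the torus\<close>

lemma torus_rel_Image: "torus_rel D `` {P} = {Q. P - Q \<in> L}"
  by (auto simp: torus_rel_def)

lemma torus_M_class: "torus_M D (torus_rel D `` {P}) = inhom_M D P"
proof -
  have "inhom_M D Q = inhom_M D P" if "P - Q \<in> L" for Q
    using inhom_M_add_lattice[OF that, of Q] by simp
  moreover have "P - P \<in> L" using lattice_0 by simp
  ultimately have "inhom_M D ` (torus_rel D `` {P}) = {inhom_M D P}"
    unfolding torus_rel_Image by force
  thus ?thesis by (simp add: torus_M_def)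
qed

lemma quad_torus_eq: "quad_torus D = range (\<lambda>P. torus_rel D `` {P})"
  by (auto simp: quad_torus_def quotient_def)

lemma torus_M_image: "torus_M D ` quad_torus D = range (inhom_M D)"
  by (simp add: quad_torus_eq image_image torus_M_class)

text \<open>The coordinates with respect to 1 and \<open>w\<close> solve a linear system over
  \<open>K\<close>: subtracting the equations isolates \<open>y\<close>, and the determinant
  \<open>2 * b * r\<close> is nonzero.\<close>

lemma K_point_class:
  assumes "s \<in> K" "u \<in> K"
  shows "torus_rel D `` {(s, u)} \<in> K_points D"
proof -
  obtain w a b where w: "is_int_basis D 1 w" "quad_embed D w = (a - b * r, a + b * r)" "b \<noteq> 0"
    using int_basis_exists by blast
  have w': "a + b * r = w" using w(2) by (simp add: quad_embed_def)
  have wK: "w \<in> K" using w(1) by (simp add: is_int_basis_def quad_ints_def)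
  have "quad_embed D w \<in> L" using w(1) by (simp add: is_int_basis_def quad_lattice_def)
  hence wcK: "a - b * r \<in> K" using lattice_in_K(1) unfolding w(2) by blast
  define y where "y = (u - s) / (w - (a - b * r))"
  define x where "x = u - y * w"
  have den: "w - (a - b * r) \<noteq> 0" using w(3) r_pos by (simp flip: w')
  have yK: "y \<in> K" unfolding y_def by (intro K_divide K_diff[OF assms(2,1)] K_diff[OF wK wcK])
  have xK: "x \<in> K" unfolding x_def using assms wK yK by (intro K_diff K_mult)
  have e1: "quad_embed D 1 = (1, 1)" using conj_eq[of 1 0] by (simp add: quad_embed_def)
  have "y * (w - (a - b * r)) = u - s" using den by (simp add: y_def)
  hence "(s, u) = x *\<^sub>R quad_embed D 1 + y *\<^sub>R quad_embed D w"
    unfolding e1 w(2) w' x_def by (simp add: algebra_simps)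
  moreover have "(s, u) \<in> torus_rel D `` {(s, u)}" unfolding torus_rel_Image using lattice_0 by simp
  moreover have "torus_rel D `` {(s, u)} \<in> quad_torus D" unfolding quad_torus_eq by (rule rangeI)
  ultimately show ?thesis unfolding K_points_def
    by (intro CollectI conjI bexI[of _ "(s, u)"] exI[of _ 1] exI[of _ w] bexI[of _ x] bexI[of _ y] w(1) xK yK)
qed

text \<open>For rational \<open>a\<close> and \<open>b\<close> the point is the image of a field
  element, so its differences with the lattice have field norms of bounded denominator. This
  discreteness is used in \<open>inhom_M_in_K\<close>.\<close>

lemma rational_point_norm_denom:
  assumes "a \<in> \<rat>" "b \<in> \<rat>"
  obtains d :: int where "d > 0" "\<And>Q. Q \<in> L \<Longrightarrow> of_int d * abs_norm ((a - b * r, a + b * r) - Q) \<in> \<int>"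
proof -
  obtain i j where a: "a = of_int i / of_int j" "j > 0" using assms(1) by (metis Rats_cases')
  obtain k l where b: "b = of_int k / of_int l" "l > 0" using assms(2) by (metis Rats_cases')
  show ?thesis
  proof (rule that)
    show "(2 * j * l)\<^sup>2 > 0" using a b by simp
    fix Q assume "Q \<in> L"
    then obtain m n where Q: "Q = ((of_int m - of_int n * r) / 2, (of_int m + of_int n * r) / 2)"
      using lattice_E by blast
    define x y where "x = 2 * i * l - j * l * m" and "y = 2 * k * j - j * l * n"
    have xy: "of_int (2 * j * l) * (a - of_int m / 2) = of_int x" "of_int (2 * j * l) * (b - of_int n / 2) = of_int y"
      using a b by (simp_all add: x_def y_def field_simps)
    have "(a - b * r - (of_int m - of_int n * r) / 2) * (a + b * r - (of_int m + of_int n * r) / 2)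
        = (a - of_int m / 2)\<^sup>2 - of_int D * (b - of_int n / 2)\<^sup>2"
      unfolding r_sq[symmetric] by (simp add: field_simps power2_eq_square del: r_sq)
    hence "of_int ((2 * j * l)\<^sup>2) * abs_norm ((a - b * r, a + b * r) - Q) =
        \<bar>(of_int (2 * j * l))\<^sup>2 * ((a - of_int m / 2)\<^sup>2 - of_int D * (b - of_int n / 2)\<^sup>2)\<bar>"
      by (simp only: abs_norm_def Q diff_Pair fst_conv snd_conv of_int_power abs_mult abs_power2)
    also have "\<dots> = \<bar>(of_int (2 * j * l) * (a - of_int m / 2))\<^sup>2 - of_int D * (of_int (2 * j * l) * (b - of_int n / 2))\<^sup>2\<bar>"
      unfolding power_mult_distrib by (simp only: right_diff_distrib mult.left_commute)
    also have "\<dots> = of_int \<bar>x\<^sup>2 - D * y\<^sup>2\<bar>" unfolding xy by simp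
    finally show "of_int ((2 * j * l)\<^sup>2) * abs_norm ((a - b * r, a + b * r) - Q) \<in> \<int>" by simp
  qed
qed

end

subsection \<open>Shadowing by \<open>K\<close>-points\<close>

context real_quadratic_unit
begin

lemma e_powi_le_1: "k \<le> 0 \<Longrightarrow> e powi k \<le> 1"
  using power_int_increasing[of k 0 e] e_gt_1 by simp

text \<open>Modulo the lattice the forward orbit stays in a compact box, so a convergent subsequence
  has two terms as close as required.\<close>

lemma recurrence:
  assumes "\<eta> > 0"
  obtains a b :: nat and Q where "a < b" "Q \<in> L" "within_box \<eta> (act (int b) P - act (int a) P - Q)"
proof -
  have "\<exists>Q\<in>L. within_box (1 + r) (act (int k) P - Q)" for k
    unfolding within_box_def using lattice_covering by blast
  then obtain q where q: "\<And>k. q k \<in> L" "\<And>k. within_box (1 + r) (act (int k) P - q k)" by metis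
  define X where "X = (\<lambda>k. act (int k) P - q k)"
  have "X k \<in> cbox (- (1 + r), - (1 + r)) (1 + r, 1 + r)" for k
  proof -
    have "fst (X k) \<in> {- (1 + r)..1 + r}" "snd (X k) \<in> {- (1 + r)..1 + r}"
      using q(2)[of k] by (auto simp: within_box_def X_def abs_le_iff)
    thus ?thesis by (cases "X k") (auto simp: cbox_Pair_eq)
  qed
  then obtain l \<rho> where \<rho>: "strict_mono \<rho>" "(X \<circ> \<rho>) \<longlonglongrightarrow> l"
    using compact_cbox unfolding compact_def by meson
  hence "Cauchy (X \<circ> \<rho>)" by (intro LIMSEQ_imp_Cauchy)
  then obtain N where N: "\<And>m n. m \<ge> N \<Longrightarrow> n \<ge> N \<Longrightarrow> dist ((X \<circ> \<rho>) m) ((X \<circ> \<rho>) n) < \<eta>"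
    unfolding Cauchy_def using assms by meson
  define a b where "a = \<rho> N" and "b = \<rho> (Suc N)"
  have d: "dist (X b) (X a) < \<eta>" using N[of "Suc N" N] by (simp add: a_def b_def)
  have "within_box \<eta> (X b - X a)"
    using d dist_fst_le[of "X b" "X a"] dist_snd_le[of "X b" "X a"]
    by (simp add: within_box_def dist_real_def)
  moreover have "X b - X a = act (int b) P - act (int a) P - (q b - q a)" by (simp add: X_def)
  moreover have "a < b" using \<rho>(1) by (simp add: a_def b_def strict_mono_def)
  ultimately show ?thesis using that[of a b "q b - q a"] q(1) lattice_diff by metis
qed

text \<open>
  The forward orbit of \<open>P\<close> nearly closes up at some time; the point of \<open>K\<^sup>2\<close> fixed by the
  corresponding power of the unit up to a lattice translation supplies the coordinate \<open>u'\<close>.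
\<close>

lemma shadow_forward:
  assumes "\<eta> > 0"
  obtains u' where "u' \<in> K" "\<bar>u' - snd P\<bar> \<le> \<eta>"
    "\<And>s' k. \<bar>s' - fst P\<bar> \<le> \<eta> \<Longrightarrow> k \<ge> 0 \<Longrightarrow>
       \<exists>j. \<exists>Q\<in>L. within_box (3 * \<eta>) (act k (s', u') - act j P - Q)"
proof -
  \<comment> \<open>Closing up will divide by \<open>1 - inverse E\<close> with
    \<open>E \<ge> e\<close>; this factor keeps the corrections at most \<open>\<eta>\<close>
    whatever the return time.\<close>
  define \<sigma> where "\<sigma> = \<eta> * (1 - inverse e)"
  have e1: "1 - inverse e > 0" using e_gt_1 by (simp add: field_simps)
  hence "\<sigma> > 0" using assms by (simp add: \<sigma>_def)
  then obtain a b Q0 where ab: "a < b" "Q0 \<in> L" "within_box \<sigma> (act (int b) P - act (int a) P - Q0)"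
    by (rule recurrence)
  define n where "n = int b - int a"
  have n: "n > 0" using ab by (simp add: n_def)
  define W where "W = act (int a) P"
  have W: "act n W = act (int b) P" by (simp add: W_def act_act n_def)
  define t where "t = act n W - W - Q0"
  have t: "\<bar>fst t\<bar> \<le> \<sigma>" "\<bar>snd t\<bar> \<le> \<sigma>" using ab(3) unfolding t_def W by (simp_all add: within_box_def W_def)
  define E where "E = e powi n"
  have Ee: "E \<ge> e" unfolding E_def using power_int_increasing[of 1 n e] n e_gt_1 by simp
  hence E: "E > 1" using e_gt_1 by simp
  \<comment> \<open>The pair solves \<open>act n (x, y) = (x, y) - t\<close>, so adding it to
    \<open>W\<close> cancels the defect \<open>t\<close> and closes the orbit exactly modulo the
    lattice.\<close>
  define x where "x = fst t / (1 - inverse E)"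
  define y where "y = - snd t / (E - 1)"
  define R where "R = W + (x, y)"
  have E1: "1 - inverse E \<ge> 1 - inverse e" using Ee E e_pos by (simp add: le_imp_inverse_le)
  have \<sigma>E: "\<sigma> / (1 - inverse E) \<le> \<eta>"
    using E1 e1 assms by (simp add: \<sigma>_def divide_le_eq mult_left_mono)
  have x: "\<bar>x\<bar> \<le> \<eta>"
  proof -
    have "\<bar>x\<bar> = \<bar>fst t\<bar> / (1 - inverse E)" using E1 e1 by (simp add: x_def)
    also have "\<dots> \<le> \<sigma> / (1 - inverse E)" using t E1 e1 by (intro divide_right_mono) auto
    finally show ?thesis using \<sigma>E by simp
  qed
  \<comment> \<open>The factor \<open>E\<close> is kept because \<open>y\<close> grows by it over
    one period.\<close>
  have y: "E * \<bar>y\<bar> \<le> \<eta>"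
  proof -
    have "E * \<bar>y\<bar> = \<bar>snd t\<bar> / (1 - inverse E)" using E by (simp add: y_def field_simps)
    also have "\<dots> \<le> \<sigma> / (1 - inverse E)" using t E1 e1 by (intro divide_right_mono) auto
    finally show ?thesis using \<sigma>E by simp
  qed
  have "1 * \<bar>y\<bar> \<le> E * \<bar>y\<bar>" using E by (intro mult_right_mono) auto
  hence y': "\<bar>y\<bar> \<le> \<eta>" using y by simp
  have R: "act n R = R + Q0"
  proof -
    have "x * inverse E = x - fst t" using E by (simp add: x_def field_simps)
    moreover have "y * E = y - snd t" using E by (simp add: y_def field_simps)
    ultimately have "act n (x, y) = (x, y) - t"
      by (simp add: act_def E_def[symmetric] power_int_minus prod_eq_iff)
    thus ?thesis unfolding R_def act_add by (simp add: t_def)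
  qed
  have "snd R * E = snd R + snd Q0" using arg_cong[OF R, of snd] by (simp add: snd_act E_def)
  hence "snd R = snd Q0 / (E - 1)" using E by (simp add: field_simps)
  moreover have "snd Q0 \<in> K" using ab(2) lattice_in_K(2) by (metis prod.collapse)
  moreover have "E - 1 \<in> K" unfolding E_def by (intro K_diff K_power_int e_K K_Rats) auto
  ultimately have RK: "snd R \<in> K" using K_divide by simp
  \<comment> \<open>Periodicity replaces any time \<open>i\<close> by one between 0 and
    \<open>n\<close>, up to the lattice.\<close>
  have orb: "\<exists>j. 0 \<le> j \<and> j \<le> n \<and> (\<exists>Q\<in>L. act (int i) R = act j R + Q)" for i :: nat
  proof (induction i rule: less_induct)
    case (less i)
    show ?case
    proof (cases "int i \<le> n")
      case True
      thus ?thesis using lattice_0 by (intro exI[of _ "int i"]) (auto intro!: bexI[of _ 0])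
    next
      case False
      define i' where "i' = nat (int i - n)"
      have i': "i' < i" "int i' = int i - n" using False n by (auto simp: i'_def)
      from less[OF i'(1)] obtain j Q where j: "0 \<le> j" "j \<le> n" "Q \<in> L" "act (int i') R = act j R + Q"
        by blast
      have "act (int i) R = act (int i') (act n R)" by (simp add: act_act i')
      also have "\<dots> = act j R + (Q + act (int i') Q0)" by (simp add: R act_add j add.assoc)
      finally show ?thesis using j act_lattice ab(2) lattice_add by blast
    qed
  qed
  \<comment> \<open>Only the expanding coordinate of the periodic orbit is pulled back to time 0;
    the first coordinate may vary, as it contracts in forward time.\<close>
  define u' where "u' = snd R * e powi (- int a)"
  have snd_u: "u' - snd P = y * e powi (- int a)"
    by (simp add: u'_def R_def W_def snd_act power_int_minus field_simps)
  have fst_R: "fst R = fst P * e powi (- int a) + x"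
    by (simp add: R_def W_def fst_act)
  show ?thesis
  proof (rule that)
    show "u' \<in> K" unfolding u'_def by (intro K_mult RK K_power_int e_K)
    have "\<bar>y\<bar> * e powi (- int a) \<le> \<eta> * 1"
      using y' assms by (intro mult_mono e_powi_le_1) auto
    thus "\<bar>u' - snd P\<bar> \<le> \<eta>" by (simp add: snd_u abs_mult)
    fix s' :: real and k :: int
    assume s': "\<bar>s' - fst P\<bar> \<le> \<eta>" and k: "k \<ge> 0"
    have s'k: "\<bar>s' - fst P\<bar> * e powi (- k) \<le> \<eta> * 1"
      using k s' assms by (intro mult_mono e_powi_le_1) auto
    show "\<exists>j. \<exists>Q\<in>L. within_box (3 * \<eta>) (act k (s', u') - act j P - Q)"
    \<comment> \<open>Up to time \<open>a\<close> the orbit follows that of \<open>P\<close> itself;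
      later it follows \<open>R\<close>, which stays near the orbit of \<open>P\<close> between
      times \<open>a\<close> and \<open>a + n\<close>.\<close>
    proof (cases "k \<le> int a")
      case True
      have 1: "fst (act k (s', u') - act k P - 0) = (s' - fst P) * e powi (- k)"
        by (simp add: fst_act algebra_simps)
      have "snd (act k (s', u') - act k P - 0) = (u' - snd P) * e powi k"
        by (simp add: snd_act algebra_simps)
      also have "\<dots> = y * e powi (k - int a)"
        by (simp add: snd_u mult.assoc flip: power_int_add)
      finally have 2: "snd (act k (s', u') - act k P - 0) = y * e powi (k - int a)" .
      have "\<bar>y\<bar> * e powi (k - int a) \<le> \<eta> * 1"
        using True y' assms by (intro mult_mono e_powi_le_1) auto
      hence "within_box (3 * \<eta>) (act k (s', u') - act k P - 0)"
        unfolding within_box_def 1 2 using s'k assms by (simp add: abs_mult)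
      thus ?thesis using lattice_0 by blast
    next
      case False
      define i where "i = nat (k - int a)"
      have i: "int i = k - int a" using False by (simp add: i_def)
      obtain j Q where j: "0 \<le> j" "j \<le> n" "Q \<in> L" "act (int i) R = act j R + Q"
        using orb by blast
      have Rj: "act j R = act (j + int a) P + (x * e powi (- j), y * e powi j)"
        unfolding R_def act_add W_def act_act by (simp add: act_def)
      have pw: "e powi (- k) = e powi (- int a) * e powi (- int i)" "e powi k = e powi (int a) * e powi (int i)"
        using i by (simp_all flip: power_int_add power_int_of_nat)
      have "act k (s', u') = act (int i) R + ((s' - fst P) * e powi (- k) - x * e powi (- int i), 0)"
        unfolding act_def u'_def fst_R fst_conv snd_conv pw by (simp add: algebra_simps power_int_minus)
      \<comment> \<open>The first coordinate has three contracted errors of at most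
        \<open>\<eta>\<close> each: the freedom in \<open>s'\<close>, and the correction
        \<open>x\<close> at times \<open>i\<close> and \<open>j\<close>.\<close>
      hence eq: "act k (s', u') - act (j + int a) P - Q =
          ((s' - fst P) * e powi (- k) - x * e powi (- int i) + x * e powi (- j), y * e powi j)"
        unfolding j(4) Rj by simp
      have "\<bar>x\<bar> * e powi (- int i) \<le> \<eta> * 1" "\<bar>x\<bar> * e powi (- j) \<le> \<eta> * 1"
        using x assms j by (intro mult_mono e_powi_le_1; simp)+
      hence "\<bar>(s' - fst P) * e powi (- k) - x * e powi (- int i) + x * e powi (- j)\<bar> \<le> 3 * \<eta>"
        using s'k abs_mult[of "s' - fst P" "e powi (- k)"] abs_mult[of x "e powi (- int i)"]
          abs_mult[of x "e powi (- j)"] by (simp only: abs_e_powi) linarith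
      moreover have "\<bar>y\<bar> * e powi j \<le> \<bar>y\<bar> * E"
        unfolding E_def using j e_gt_1 by (intro mult_left_mono power_int_increasing) auto
      hence "\<bar>y * e powi j\<bar> \<le> 3 * \<eta>" using y assms by (simp add: abs_mult mult.commute)
      ultimately have "within_box (3 * \<eta>) (act k (s', u') - act (j + int a) P - Q)"
        unfolding eq within_box_def by simp
      thus ?thesis using j(3) by blast
    qed
  qed
qed

text \<open>A lattice point giving \<open>P'\<close> a norm of at most \<open>inhom_M D P\<close> is
  balanced into a box by some \<open>act k\<close>. There the orbit of \<open>P'\<close> is close to
  that of \<open>P\<close>, and pulling back gives a lattice point for \<open>P\<close> with almost
  the same norm.\<close>

lemma inhom_M_ge_of_shadowing:
  assumes "0 \<le> \<eta>" "\<eta> \<le> 1"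
    and shadow: "\<And>k. \<exists>j. \<exists>Q\<in>L. within_box \<eta> (act k P' - act j P - Q)"
  shows "inhom_M D P' \<ge> inhom_M D P - (2 * (inhom_M D P + e) + 1) * \<eta>"
proof (rule inhom_M_ge)
  fix Q assume Q: "Q \<in> L"
  define B where "B = inhom_M D P + e"
  have B: "B \<ge> 0" using inhom_M_nonneg[of P] by (simp add: B_def less_imp_le add_nonneg_nonneg)
  show "inhom_M D P - (2 * (inhom_M D P + e) + 1) * \<eta> \<le> abs_norm (P' - Q)"
  proof (cases "abs_norm (P' - Q) \<le> inhom_M D P")
    case False
    thus ?thesis using B assms(1) unfolding B_def[symmetric]
      by (smt (verit) mult_nonneg_nonneg)
  next
    case True
    then obtain k where k: "within_box B (act k (P' - Q))"
      unfolding within_box_def B_def using act_into_box by blast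
    obtain j Q1 where j: "Q1 \<in> L" "within_box \<eta> (act k P' - act j P - Q1)" using shadow by blast
    define d where "d = act k P' - act j P - Q1"
    \<comment> \<open>Chosen so that \<open>act j (P - Q')\<close> differs from the balanced
      \<open>act k (P' - Q)\<close> by \<open>d\<close> only.\<close>
    define Q' where "Q' = act (- j) (act k Q - Q1)"
    have Q': "Q' \<in> L" unfolding Q'_def by (intro act_lattice lattice_diff Q j)
    have "act k (P' - Q) + - d = act j (P - Q')"
      by (simp add: act_diff Q'_def act_act d_def)
    moreover have "within_box \<eta> (- d)" using j(2) unfolding d_def[symmetric] by (simp add: within_box_def)
    ultimately have "abs_norm (act j (P - Q')) \<le> abs_norm (act k (P' - Q)) + (2 * B + 1) * \<eta>"
      using abs_norm_perturb[OF k _ assms(2), of "- d"] by simp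
    moreover have "inhom_M D P \<le> abs_norm (P - Q')" using Q' by (rule inhom_M_le)
    ultimately show ?thesis by (simp add: B_def)
  qed
qed

text \<open>Semicontinuity bounds the new value from above, shadowing from below. \<open>u'\<close>
  controls the forward orbit and \<open>s'\<close> the backward one; they are chosen independently,
  since each statement leaves the other coordinate free up to \<open>\<eta>\<close>.\<close>

lemma inhom_M_approx_K:
  assumes "\<delta> > 0"
  obtains s' u' where "s' \<in> K" "u' \<in> K" "\<bar>inhom_M D (s', u') - inhom_M D P\<bar> \<le> \<delta>"
proof -
  obtain \<eta>0 where \<eta>0: "\<eta>0 > 0" "\<And>P'. within_box \<eta>0 (P' - P) \<Longrightarrow> inhom_M D P' \<le> inhom_M D P + \<delta>"
    using inhom_M_upper_semicontinuous[OF assms, of P] by blast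
  define C where "C = 2 * (inhom_M D P + e) + 1"
  have C: "C > 0" unfolding C_def using inhom_M_nonneg[of P]
    by (intro add_pos_pos mult_pos_pos add_nonneg_pos) auto
  \<comment> \<open>The bounds serve semicontinuity, \<open>3 * \<eta> \<le> 1\<close>, and a loss
    of at most \<open>\<delta>\<close> from shadowing.\<close>
  define \<eta> where "\<eta> = min \<eta>0 (min (1 / 3) (\<delta> / (3 * C)))"
  have \<eta>: "\<eta> > 0" "\<eta> \<le> \<eta>0" "3 * \<eta> \<le> 1" using \<eta>0 C assms by (auto simp: \<eta>_def)
  have "\<eta> \<le> \<delta> / (3 * C)" by (simp add: \<eta>_def)
  hence C\<eta>: "C * (3 * \<eta>) \<le> \<delta>" using C by (simp add: field_simps)
  obtain u' where u': "u' \<in> K" "\<bar>u' - snd P\<bar> \<le> \<eta>"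
    "\<And>s' k. \<bar>s' - fst P\<bar> \<le> \<eta> \<Longrightarrow> k \<ge> 0 \<Longrightarrow>
       \<exists>j. \<exists>Q\<in>L. within_box (3 * \<eta>) (act k (s', u') - act j P - Q)"
    using shadow_forward[OF \<eta>(1), of P] by blast
  \<comment> \<open>After the swap time is reversed, so the forward statement covers negative
    times.\<close>
  obtain s' where s': "s' \<in> K" "\<bar>s' - snd (prod.swap P)\<bar> \<le> \<eta>"
    "\<And>u' k. \<bar>u' - fst (prod.swap P)\<bar> \<le> \<eta> \<Longrightarrow> k \<ge> 0 \<Longrightarrow>
       \<exists>j. \<exists>Q\<in>L. within_box (3 * \<eta>) (act k (u', s') - act j (prod.swap P) - Q)"
    using shadow_forward[OF \<eta>(1), of "prod.swap P"] by blast
  have "\<exists>j. \<exists>Q\<in>L. within_box (3 * \<eta>) (act k (s', u') - act j P - Q)" for k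
  proof (cases "k \<ge> 0")
    case True
    thus ?thesis using u'(3) s'(2) by simp
  next
    case False
    then obtain j Q where j: "Q \<in> L" "within_box (3 * \<eta>) (act (- k) (u', s') - act j (prod.swap P) - Q)"
      using s'(3)[of u' "- k"] u'(2) by auto
    have "act k (s', u') - act (- j) P - prod.swap Q =
        prod.swap (act (- k) (u', s') - act j (prod.swap P) - Q)"
      by (simp add: act_def prod.swap_def)
    hence "within_box (3 * \<eta>) (act k (s', u') - act (- j) P - prod.swap Q)"
      using j(2) by (simp add: within_box_def)
    thus ?thesis using lattice_swap[OF j(1)] by blast
  qed
  hence "inhom_M D (s', u') \<ge> inhom_M D P - C * (3 * \<eta>)"
    unfolding C_def using \<eta> by (intro inhom_M_ge_of_shadowing) auto
  moreover have "inhom_M D (s', u') \<le> inhom_M D P + \<delta>"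
    using u'(2) s'(2) \<eta> by (intro \<eta>0(2)) (auto simp: within_box_def)
  ultimately have "\<bar>inhom_M D (s', u') - inhom_M D P\<bar> \<le> \<delta>" using C\<eta> by linarith
  thus ?thesis using that s'(1) u'(1) by blast
qed

text \<open>
  If the infimum is not attained, the units that balance near-optimal differences \<open>P - Q\<close> become
  arbitrarily large or small, so \<open>P\<close> may be replaced by one of the rational points sharing a
  coordinate with it, whose norms have bounded denominator.
\<close>

lemma inhom_M_in_K:
  assumes "s \<in> K" "u \<in> K"
  shows "inhom_M D (s, u) \<in> K"
proof (rule ccontr)
  define m where "m = inhom_M D (s, u)"
  assume "inhom_M D (s, u) \<notin> K"
  hence mK: "m \<notin> K" by (simp add: m_def)
  obtain a b where u: "a \<in> \<rat>" "b \<in> \<rat>" "u = a + b * r" using assms(2) by (rule K_E)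
  \<comment> \<open>The minus sign makes \<open>s\<close> the conjugate of
    \<open>a' + b' * r\<close>, so \<open>R'\<close> shares the first coordinate with the given
    point, while \<open>R\<close> shares the second.\<close>
  obtain a' b' where s: "a' \<in> \<rat>" "b' \<in> \<rat>" "s = a' - b' * r"
    using assms(1) by (metis K_E Rats_minus_iff mult_minus_left diff_minus_eq_add)
  define R where "R = (a - b * r, a + b * r)"
  define R' where "R' = (a' - b' * r, a' + b' * r)"
  obtain d1 where d1: "d1 > 0" "\<And>Q. Q \<in> L \<Longrightarrow> of_int d1 * abs_norm (R - Q) \<in> \<int>"
    using rational_point_norm_denom[OF u(1,2)] unfolding R_def by blast
  obtain d2 where d2: "d2 > 0" "\<And>Q. Q \<in> L \<Longrightarrow> of_int d2 * abs_norm (R' - Q) \<in> \<int>"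
    using rational_point_norm_denom[OF s(1,2)] unfolding R'_def by blast
  define d where "d = d1 * d2"
  have d: "d > 0" "of_int d * abs_norm (R - Q) \<in> \<int>" "of_int d * abs_norm (R' - Q) \<in> \<int>" if "Q \<in> L" for Q
  proof -
    show "d > 0" using d1 d2 by (simp add: d_def)
    have "of_int d2 * (of_int d1 * abs_norm (R - Q)) \<in> \<int>" by (rule Ints_mult[OF Ints_of_int d1(2)[OF that]])
    thus "of_int d * abs_norm (R - Q) \<in> \<int>" by (simp add: d_def mult_ac)
    have "of_int d1 * (of_int d2 * abs_norm (R' - Q)) \<in> \<int>" by (rule Ints_mult[OF Ints_of_int d2(2)[OF that]])
    thus "of_int d * abs_norm (R' - Q) \<in> \<int>" by (simp add: d_def mult_ac)
  qed
  have d0: "d > 0" using d(1) lattice_0 by blast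
  define x where "x = s - fst R"
  define y where "y = u - snd R'"
  define B where "B = m + 1 + e"
  have m0: "m \<ge> 0" unfolding m_def by (rule inhom_M_nonneg)
  have B: "B > 0" using m0 e_gt_1 by (simp add: B_def)
  have near: "\<exists>Q\<in>L. \<exists>z\<in>{abs_norm (R - Q), abs_norm (R' - Q)}. \<bar>z - m\<bar> < \<epsilon>" if "\<epsilon> > 0" for \<epsilon>
  proof -
    \<comment> \<open>Room for two errors: \<open>\<eta> * B\<close> from replacing the point and
      \<open>\<eta>\<close> from the choice of \<open>Q\<close>.\<close>
    define \<eta> where "\<eta> = \<epsilon> / (2 * (1 + B))"
    have \<eta>: "\<eta> > 0" using that B by (simp add: \<eta>_def)
    have "\<eta> * (1 + B) = \<epsilon> / 2" using B by (simp add: \<eta>_def field_simps)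
    hence \<eta>\<epsilon>: "\<eta> * (1 + B) < \<epsilon>" using that by simp
    obtain T :: nat where T: "(\<bar>x\<bar> + \<bar>y\<bar>) / \<eta> < e ^ T" using real_arch_pow e_gt_1 by blast
    have small: "\<bar>x\<bar> * e powi (- k) \<le> \<eta>" "\<bar>y\<bar> * e powi (- k) \<le> \<eta>" if "k \<ge> int T" for k
    proof -
      have "e ^ T \<le> e powi k" using power_int_increasing[OF that, of e] e_gt_1 by simp
      hence "(\<bar>x\<bar> + \<bar>y\<bar>) / \<eta> \<le> e powi k" using T by linarith
      hence le: "\<bar>x\<bar> + \<bar>y\<bar> \<le> \<eta> * e powi k" using \<eta> by (simp add: field_simps)
      have pos: "e powi k > 0" by (simp add: zero_less_power_int)
      have "\<bar>x\<bar> \<le> \<eta> * e powi k" "\<bar>y\<bar> \<le> \<eta> * e powi k" using le by linarith+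
      thus "\<bar>x\<bar> * e powi (- k) \<le> \<eta>" "\<bar>y\<bar> * e powi (- k) \<le> \<eta>"
        using pos by (simp_all add: power_int_minus field_simps)
    qed
    \<comment> \<open>Norms occurring with balancing exponents between \<open>- T\<close> and
      \<open>T\<close>: finitely many elements of \<open>K\<close>, hence at a positive distance
      \<open>\<rho>\<close> from \<open>m\<close>, which is not in \<open>K\<close>.\<close>
    define F where "F = (\<Union>k\<in>{- int T..int T}. (\<lambda>Q. abs_norm (act k (s, u) - Q)) `
      {Q \<in> L. within_box B (act k (s, u) - Q)})"
    have "finite {Q \<in> L. within_box B (P - Q)}" for P
      by (rule finite_subset[OF _ finite_lattice_box[of "B + \<bar>fst P\<bar> + \<bar>snd P\<bar>"]])
         (auto simp: within_box_def)
    hence "finite F" unfolding F_def by blast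
    then obtain \<rho> where \<rho>: "\<rho> > 0" "\<And>f. f \<in> F \<Longrightarrow> f \<noteq> m \<Longrightarrow> \<rho> \<le> dist m f"
      using finite_set_avoid[of F m] by blast
    have FK: "F \<subseteq> K"
    proof
      fix f assume "f \<in> F"
      then obtain k Q where "Q \<in> L" "f = abs_norm (act k (s, u) - Q)" by (auto simp: F_def)
      thus "f \<in> K" using assms lattice_in_K[of "fst Q" "snd Q"]
        by (auto simp: abs_norm_def act_def intro!: K_abs K_mult K_diff K_power_int e_K)
    qed
    obtain Q where Q: "Q \<in> L" "abs_norm ((s, u) - Q) < m + min 1 (min \<rho> \<eta>)"
      using inhom_M_lessE[of "(s, u)" "m + min 1 (min \<rho> \<eta>)"] \<rho>(1) \<eta> by (auto simp: m_def)
    have mQ: "m \<le> abs_norm ((s, u) - Q)" unfolding m_def using Q(1) by (rule inhom_M_le)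
    have "abs_norm ((s, u) - Q) \<le> m + 1" using Q(2) by simp
    then obtain k where k: "within_box B (act k ((s, u) - Q))"
      unfolding within_box_def B_def using act_into_box by blast
    define w where "w = act k ((s, u) - Q)"
    have w: "\<bar>fst w\<bar> \<le> B" "\<bar>snd w\<bar> \<le> B" using k by (auto simp: within_box_def w_def)
    have Nw: "\<bar>fst w * snd w\<bar> = abs_norm ((s, u) - Q)"
      using abs_norm_act[of k "(s, u) - Q"] by (simp add: abs_norm_def w_def)
    \<comment> \<open>A norm closer to \<open>m\<close> than \<open>\<rho>\<close> cannot belong to
      \<open>F\<close>, so the exponent is large in absolute value.\<close>
    have "\<not> (- int T \<le> k \<and> k \<le> int T)"
    proof
      assume kT: "- int T \<le> k \<and> k \<le> int T"
      have "abs_norm (act k (s, u) - act k Q) \<in> F"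
        unfolding F_def using kT k act_lattice[OF Q(1), of k]
        by (intro UN_I[of k] imageI) (auto simp: act_diff)
      hence "abs_norm ((s, u) - Q) \<in> F" by (simp flip: act_diff)
      moreover from this have "abs_norm ((s, u) - Q) \<noteq> m" using FK mK by blast
      ultimately show False using \<rho>(2)[of "abs_norm ((s, u) - Q)"] mQ Q(2) by (simp add: dist_real_def)
    qed
    then consider "k \<ge> int T" | "- k \<ge> int T" by linarith
    thus ?thesis
    proof cases
      case 1
      have wR: "act k (R - Q) = (fst w - x * e powi (- k), snd w)"
        using u(3) by (auto simp: w_def act_def x_def R_def algebra_simps)
      have "abs_norm (R - Q) = \<bar>(fst w - x * e powi (- k)) * snd w\<bar>"
        using abs_norm_act[of k "R - Q"] unfolding wR by (simp add: abs_norm_def)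
      hence "\<bar>abs_norm (R - Q) - abs_norm ((s, u) - Q)\<bar> \<le> \<bar>x * e powi (- k) * snd w\<bar>"
        unfolding Nw[symmetric] by (simp add: left_diff_distrib)
      also have "\<dots> = (\<bar>x\<bar> * e powi (- k)) * \<bar>snd w\<bar>" by (simp add: abs_mult)
      also have "\<dots> \<le> \<eta> * B" using small(1)[OF 1] w \<eta> by (intro mult_mono) auto
      finally have "\<bar>abs_norm (R - Q) - m\<bar> < \<epsilon>"
        using Q(2) mQ \<eta>\<epsilon> by (simp add: algebra_simps)
      thus ?thesis using Q(1) by blast
    next
      case 2
      have wR: "act k (R' - Q) = (fst w, snd w - y * e powi k)"
        using s(3) by (auto simp: w_def act_def y_def R'_def algebra_simps)
      have "abs_norm (R' - Q) = \<bar>fst w * (snd w - y * e powi k)\<bar>"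
        using abs_norm_act[of k "R' - Q"] unfolding wR by (simp add: abs_norm_def)
      hence "\<bar>abs_norm (R' - Q) - abs_norm ((s, u) - Q)\<bar> \<le> \<bar>fst w * (y * e powi k)\<bar>"
        unfolding Nw[symmetric] by (simp add: right_diff_distrib)
      also have "\<dots> = \<bar>fst w\<bar> * (\<bar>y\<bar> * e powi (- (- k)))" by (simp add: abs_mult)
      also have "\<dots> \<le> B * \<eta>" using small(2)[OF 2] w \<eta> B by (intro mult_mono) auto
      finally have "\<bar>abs_norm (R' - Q) - m\<bar> < \<epsilon>"
        using Q(2) mQ \<eta>\<epsilon> by (simp add: algebra_simps)
      thus ?thesis using Q(1) by blast
    qed
  qed
  \<comment> \<open>Integers approximate \<open>d * m\<close> arbitrarily well and form a closed
    set, so \<open>m\<close> is rational.\<close>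
  have "\<exists>z\<in>\<int>. dist z (of_int d * m) < \<epsilon>" if "\<epsilon> > 0" for \<epsilon> :: real
  proof -
    have "\<epsilon> / of_int d > 0" using that d0 by simp
    from near[OF this] obtain Q z where z: "Q \<in> L" "z \<in> {abs_norm (R - Q), abs_norm (R' - Q)}" "\<bar>z - m\<bar> < \<epsilon> / of_int d"
      by blast
    have "of_int d * z \<in> \<int>" using z(2) d(2,3)[OF z(1)] by blast
    moreover have "dist (of_int d * z) (of_int d * m) = of_int d * \<bar>z - m\<bar>"
      using d0 by (simp add: dist_real_def abs_mult flip: right_diff_distrib)
    moreover have "of_int d * \<bar>z - m\<bar> < \<epsilon>" using z(3) d0 by (simp add: field_simps)
    ultimately show ?thesis by metis
  qed
  hence "of_int d * m \<in> \<int>" using closed_approachable[OF closed_Ints] by blast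
  then obtain z where "of_int d * m = of_int z" by (elim Ints_cases)
  hence "m = of_int z / of_int d" using d0 by (simp add: field_simps)
  hence "m \<in> K" by (intro K_Rats) simp
  thus False using mK by blast
qed

end

section \<open>Isolated minima\<close>

theorem corollary1:
  fixes D :: int and i :: nat
  assumes "D > 1" and "squarefree D"
    and "min_considered D i" and "isolated_min D i"
  shows "(\<exists>P\<in>K_points D. torus_M D P = inhom_min D i) \<and> inhom_min D i \<in> quad_field D"
proof -
  have rq: "real_quadratic D" using assms by unfold_locales
  obtain x y where xy: "x > 0" "y > 0" "x\<^sup>2 - D * y\<^sup>2 = 1" by (rule real_quadratic.pell_ex[OF rq])
  interpret real_quadratic_unit D "of_int x + of_int y * real_quadratic.r D"
    using rq xy by (auto simp: real_quadratic_unit_def real_quadratic_unit_axioms_def)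
  define m where "m = inhom_min D i"
  define V where "V = range (inhom_M D)"
  have V0: "0 \<in> V" unfolding V_def using inhom_M_0 by (metis rangeI)
  have bddV: "bdd_above V" unfolding V_def using inhom_M_bounded by (intro bdd_aboveI2)
  have Vset: "{torus_M D X | X. X \<in> quad_torus D \<and> torus_M D X < c} = {v \<in> V. v < c}" for c
    unfolding V_def torus_M_image[symmetric] by auto
  have i: "i \<ge> 1" using assms(3) by (simp add: min_considered_def)
  have next_min: "inhom_min D (Suc i) = Sup {v \<in> V. v < m}"
    using i by (cases i) (simp_all add: Vset m_def)
  have lt: "Sup {v \<in> V. v < m} < m"
    using assms(4) by (simp add: isolated_min_def next_min m_def)
  \<comment> \<open>\<open>A\<close> is the set of values whose supremum defines \<open>m\<close>:
    all values if \<open>i = 1\<close>, else those below the previous minimum. The openness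
    condition lets both cases be treated alike.\<close>
  obtain A where A: "A \<subseteq> V" "A \<noteq> {}" "m = Sup A"
    and A_open: "\<And>v. v \<in> A \<Longrightarrow> \<exists>\<delta>>0. \<forall>w\<in>V. w < v + \<delta> \<longrightarrow> w \<in> A"
  proof (cases "i = 1")
    case True
    show ?thesis
    proof (rule that)
      show "m = Sup V" unfolding m_def V_def torus_M_image[symmetric] by (simp add: True)
    qed (use V0 in \<open>auto intro: exI[of _ 1]\<close>)
  next
    case False
    then obtain k where k: "i = Suc (Suc k)" using i by (metis One_nat_def Suc_le_D old.nat.exhaust)
    define c where "c = inhom_min D (Suc k)"
    have m: "m = Sup {v \<in> V. v < c}" by (simp add: m_def k Vset c_def)
    have mc: "m < c" using assms(3) by (simp add: min_considered_def isolated_min_def k m_def c_def del: inhom_min.simps)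
    show ?thesis
    proof (rule that)
      show "{v \<in> V. v < c} \<noteq> {}"
      proof
        \<comment> \<open>\<open>Sup {}\<close> is some fixed real. The set of values below
          \<open>m\<close> would be empty too, so both suprema would be that number, contrary to
          isolation.\<close>
        assume empty: "{v \<in> V. v < c} = {}"
        hence "{v \<in> V. v < m} = {}" using mc by force
        hence "Sup {v \<in> V. v < m} = m" using m empty by metis
        thus False using lt by simp
      qed
      show "\<exists>\<delta>>0. \<forall>w\<in>V. w < v + \<delta> \<longrightarrow> w \<in> {v \<in> V. v < c}" if "v \<in> {v \<in> V. v < c}" for v
        using that by (intro exI[of _ "c - v"]) auto
    qed (use m in auto)
  qed
  have bddA: "bdd_above A" using bddV A(1) by (rule bdd_above_mono)
  have A_le: "v \<le> m" if "v \<in> A" for v using cSup_upper[OF that bddA] A(3) by simp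
  have bdd': "bdd_above {v \<in> V. v < m}" by (auto intro: bdd_aboveI[of _ m])
  \<comment> \<open>If \<open>m\<close> were not attained, \<open>A\<close> would consist of values
    below \<open>m\<close>, whose supremum is smaller than \<open>m\<close> by isolation.\<close>
  have "m \<in> A"
  proof (rule ccontr)
    assume "m \<notin> A"
    hence "v < m" if "v \<in> A" for v using A_le[OF that] that by (cases "v = m") auto
    hence "A \<subseteq> {v \<in> V. v < m}" using A(1) by blast
    hence "m \<le> Sup {v \<in> V. v < m}" unfolding A(3) using A(2) bdd' A(3) by (intro cSup_subset_mono) auto
    thus False using lt by simp
  qed
  then obtain P where P: "m = inhom_M D P" using A(1) by (auto simp: V_def)
  obtain \<delta>1 where \<delta>1: "\<delta>1 > 0" "\<And>w. w \<in> V \<Longrightarrow> w < m + \<delta>1 \<Longrightarrow> w \<in> A"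
    using A_open[OF \<open>m \<in> A\<close>] by blast
  \<comment> \<open>Values within \<open>\<delta>\<close> of \<open>m\<close> lie in
    \<open>A\<close>, so they do not exceed \<open>m\<close>, and the gap below \<open>m\<close>
    excludes smaller ones; such a value equals \<open>m\<close>.\<close>
  define \<delta> where "\<delta> = min \<delta>1 (m - Sup {v \<in> V. v < m}) / 2"
  have \<delta>: "\<delta> > 0" "\<delta> < \<delta>1" "\<delta> < m - Sup {v \<in> V. v < m}" using \<delta>1 lt by (auto simp: \<delta>_def)
  obtain s u where su: "s \<in> quad_field D" "u \<in> quad_field D" "\<bar>inhom_M D (s, u) - m\<bar> \<le> \<delta>"
    using inhom_M_approx_K[OF \<delta>(1), of P] unfolding P by blast
  have inV: "inhom_M D (s, u) \<in> V" by (simp add: V_def)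
  have "inhom_M D (s, u) \<le> m" using su(3) \<delta> inV by (intro A_le \<delta>1(2)) auto
  moreover have "\<not> inhom_M D (s, u) < m"
  proof
    assume "inhom_M D (s, u) < m"
    hence "inhom_M D (s, u) \<le> Sup {v \<in> V. v < m}" using inV bdd' by (intro cSup_upper) auto
    thus False using su(3) \<delta>(3) by simp
  qed
  ultimately have M: "inhom_M D (s, u) = m" by simp
  have "torus_M D (torus_rel D `` {(s, u)}) = m" by (simp add: torus_M_class M)
  moreover have "m \<in> quad_field D" using inhom_M_in_K[OF su(1,2)] M by simp
  ultimately show ?thesis using K_point_class[OF su(1,2)] unfolding m_def by blast
qed

end
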